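(* Let $k \geq 0$ be an integer and let $G$ be a mop of order $n \geq k+4$. Then \[\iota_k(G) \leq \frac{n}{k+4}.\] Moreover, the bound is sharp: for each $k\ge 0$ there are infinitely many values of $n$ for which there is an $n$-vertex mop $G$ attaining equality.
   Context: All graphs are finite and simple. The order of $G$ is $|V(G)|$. A triangulated disc is a plane graph whose interior faces are triangles and whose exterior (unbounded) face is bounded by a simple cycle. A maximal outerplanar graph, or mop, is a triangulated disc $G$ such that the boundary of the exterior face of $G$ contains all the vertices of $G$ (so a mop has at least 3 vertices). For $S\subseteq V(G)$, $N_G[S]$ is the closed neighborhood of $S$, i.e. $S$ together with all vertices adjacent to a vertex of $S$; $G-N_G[S]$ is the subgraph induced by the remaining vertices. A set $S\subseteq V(G)$ is a $K_{1,k+1}$-isolating set of $G$ if $G-N_G[S]$ contains no copy of the star $K_{1,k+1}$ (equivalently for $k\ge 0$, every vertex of $G-N_G[S]$ has degree at most $k$ in $G-N_G[S]$). $\iota_k(G)$ denotes the minimum size of a $K_{1,k+1}$-isolating set of $G$. *)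

theory Defs
  imports "HOL-Analysis.Analysis"
begin

section \<open>Finite simple graphs\<close>

record 'a graph =
  verts :: "'a set"
  edges :: "'a set set"

definition simple_graph :: "('a, 'b) graph_scheme \<Rightarrow> bool" where
  "simple_graph G \<longleftrightarrow> finite (verts G) \<and> (\<forall>e \<in> edges G. e \<subseteq> verts G \<and> card e = 2)"

definition graph_order :: "('a, 'b) graph_scheme \<Rightarrow> nat" where
  "graph_order G = card (verts G)"

definition closed_nbhd :: "('a, 'b) graph_scheme \<Rightarrow> 'a set \<Rightarrow> 'a set" where
  "closed_nbhd G S = S \<union> {v \<in> verts G. \<exists>u \<in> S. {u, v} \<in> edges G}"

definition induced :: "('a, 'b) graph_scheme \<Rightarrow> 'a set \<Rightarrow> 'a graph" where
  "induced G W = \<lparr>verts = W, edges = {e \<in> edges G. e \<subseteq> W}\<rparr>"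

text \<open>A copy of H in G is a subgraph of G, not necessarily induced, isomorphic to H.\<close>

definition contains_copy :: "('a, 'b) graph_scheme \<Rightarrow> ('c, 'd) graph_scheme \<Rightarrow> bool" where
  "contains_copy G H \<longleftrightarrow>
     (\<exists>f. inj_on f (verts H) \<and> f ` verts H \<subseteq> verts G \<and> (\<forall>e \<in> edges H. f ` e \<in> edges G))"

definition star :: "nat \<Rightarrow> nat graph" where
  "star m = \<lparr>verts = {0..m}, edges = {{0, i} | i. i \<in> {1..m}}\<rparr>"

definition star_isolating :: "nat \<Rightarrow> ('a, 'b) graph_scheme \<Rightarrow> 'a set \<Rightarrow> bool" where
  "star_isolating k G S \<longleftrightarrow> S \<subseteq> verts G \<and>
     \<not> contains_copy (induced G (verts G - closed_nbhd G S)) (star (k + 1))"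

definition iota :: "nat \<Rightarrow> ('a, 'b) graph_scheme \<Rightarrow> nat" where
  "iota k G = Min (card ` {S. star_isolating k G S})"

definition cycle_edges :: "'a list \<Rightarrow> 'a set set" where
  "cycle_edges p = {{p ! i, p ! (Suc i mod length p)} | i. i < length p}"

definition is_cycle :: "('a, 'b) graph_scheme \<Rightarrow> 'a list \<Rightarrow> bool" where
  "is_cycle G p \<longleftrightarrow> 3 \<le> length p \<and> distinct p \<and> set p \<subseteq> verts G \<and> cycle_edges p \<subseteq> edges G"

section \<open>Plane graphs\<close>

text \<open>
  The vertices are points of the plane, and each edge comes with a curve drawing it.
  The values of the curve map outside the edge set are irrelevant.
\<close>

record plane_graph = "complex graph" +
  curve :: "complex set \<Rightarrow> real \<Rightarrow> complex"

definition plane :: "plane_graph \<Rightarrow> bool" where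
  "plane G \<longleftrightarrow> simple_graph G \<and>
     (\<forall>e \<in> edges G. arc (curve G e) \<and> {pathstart (curve G e), pathfinish (curve G e)} = e) \<and>
     (\<forall>e \<in> edges G. (path_image (curve G e) - e) \<inter> verts G = {}) \<and>
     (\<forall>e \<in> edges G. \<forall>f \<in> edges G. e \<noteq> f \<longrightarrow>
        (path_image (curve G e) - e) \<inter> path_image (curve G f) = {})"

definition support :: "plane_graph \<Rightarrow> complex set" where
  "support G = verts G \<union> (\<Union>e \<in> edges G. path_image (curve G e))"

definition faces :: "plane_graph \<Rightarrow> complex set set" where
  "faces G = components (- support G)"

definition exterior_face :: "plane_graph \<Rightarrow> complex set" where
  "exterior_face G = (THE F. F \<in> faces G \<and> \<not> bounded F)"

definition bounded_by_cycle :: "plane_graph \<Rightarrow> complex set \<Rightarrow> complex list \<Rightarrow> bool" where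
  "bounded_by_cycle G F p \<longleftrightarrow> is_cycle G p \<and>
     frontier F = (\<Union>e \<in> cycle_edges p. path_image (curve G e))"

definition triangulated_disc :: "plane_graph \<Rightarrow> bool" where
  "triangulated_disc G \<longleftrightarrow> plane G \<and>
     (\<forall>F \<in> faces G. F \<noteq> exterior_face G \<longrightarrow> (\<exists>p. length p = 3 \<and> bounded_by_cycle G F p)) \<and>
     (\<exists>p. bounded_by_cycle G (exterior_face G) p)"

definition mop :: "plane_graph \<Rightarrow> bool" where
  "mop G \<longleftrightarrow> triangulated_disc G \<and> verts G \<subseteq> frontier (exterior_face G)"

section \<open>Well-definedness of the minimum and of the exterior face\<close>

lemma iota_attained:
  assumes "finite (verts G)"
  shows "\<exists>S. star_isolating k G S \<and> card S = iota k G"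
    and "star_isolating k G S \<Longrightarrow> iota k G \<le> card S"
proof -
  have fin: "finite {S. star_isolating k G S}"
    by (rule finite_subset[of _ "Pow (verts G)"]) (auto simp: star_isolating_def assms)
  have "star_isolating k G (verts G)"
    by (auto simp: star_isolating_def contains_copy_def induced_def closed_nbhd_def star_def)
  then have "iota k G \<in> card ` {S. star_isolating k G S}"
    unfolding iota_def using fin by (intro Min_in) auto
  then show "\<exists>S. star_isolating k G S \<and> card S = iota k G" by auto
  show "star_isolating k G S \<Longrightarrow> iota k G \<le> card S"
    unfolding iota_def using fin by (intro Min_le) auto
qed

lemma compact_support:
  assumes "plane G" shows "compact (support G)"
proof -
  have "finite (edges G)"
    by (rule finite_subset[of _ "Pow (verts G)"])
       (use assms in \<open>auto simp: plane_def simple_graph_def\<close>)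
  then show ?thesis
    using assms unfolding support_def plane_def simple_graph_def
    by (intro compact_Un compact_UN) (auto intro: finite_imp_compact compact_arc_image)
qed

lemma exterior_face_unique:
  assumes "plane G"
  shows "exterior_face G \<in> faces G" "\<not> bounded (exterior_face G)"
    and "F \<in> faces G \<Longrightarrow> \<not> bounded F \<Longrightarrow> F = exterior_face G"
proof -
  have b: "bounded (- (- support G))"
    using compact_support[OF assms] compact_imp_bounded by simp
  have "\<exists>!F. F \<in> faces G \<and> \<not> bounded F"
    using cobounded_unique_unbounded_components[OF b] cobounded_unbounded_components[OF b]
    unfolding faces_def by (auto simp: Ex1_def)
  note * = theI'[OF this, folded exterior_face_def] the1_equality[OF this, folded exterior_face_def]
  from *(1) show "exterior_face G \<in> faces G" "\<not> bounded (exterior_face G)" by auto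
  show "F \<in> faces G \<Longrightarrow> \<not> bounded F \<Longrightarrow> F = exterior_face G" using *(2) by auto
qed

end

theory Submission
  imports Defs
begin

text \<open>
  A mop is treated as a triangulated polygon: number its vertices along the exterior cycle, so that
  an edge becomes a pair of numbers. Planarity says that no two edges cross, and the triangular
  faces say that every edge with a vertex strictly between its ends carries a triangle whose third
  corner lies between them. The bound is combinatorial and is proved in this model
  (\<open>exists_small_isolating\<close>); that a mop gives such a model, and that such a model can be drawn as a
  mop, are the two topological parts.

  The bound. An edge \<open>(a, b)\<close> separates the vertices between its ends from the others. So if \<open>a\<close> and
  \<open>b\<close> are dominated, a surviving vertex between them has all its surviving neighbours there too, and
  its degree is at most \<open>k\<close> as soon as at most \<open>k + 1\<close> vertices survive between \<open>a\<close> and \<open>b\<close>. If \<open>a\<close> or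
  \<open>b\<close> belongs to the set, then the third corner of the triangle on \<open>(a, b)\<close> is dominated as well, and
  \<open>k + 2\<close> vertices between them are harmless. Now take an edge \<open>(x, y)\<close> with at least \<open>k + 3\<close> vertices
  between its ends and as few as possible. Its triangle \<open>x, z, y\<close> has at most \<open>k + 2\<close> vertices behind
  each of the sides \<open>(x, z)\<close> and \<open>(z, y)\<close>, and a suitable corner alone takes care of everything between
  \<open>x\<close> and \<open>y\<close>. With at most \<open>2k + 7\<close> vertices in total, a suitable corner also takes care of the rest
  (\<open>one_vertex_isolating\<close>). Otherwise remove all vertices between \<open>x\<close> and \<open>y\<close> and argue by induction.
  If the chosen corner is \<open>z\<close>, then \<open>2k + 5\<close> vertices disappear. If it is \<open>x\<close> or \<open>y\<close>, perhaps only
  \<open>k + 3\<close> disappear, one too few; but then the edge \<open>(x, y)\<close> can also be contracted. This costs nothing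
  extra: if the contracted vertex is in the set found for the smaller polygon, replacing it by both
  \<open>x\<close> and \<open>y\<close> adds one vertex, just as adding a corner does.

  From mops to the model. Two crossing chords are excluded by cutting the Jordan curve of the exterior
  cycle along one of them (\<open>chords_noncrossing\<close>). The triangle on an edge comes from a face that
  touches the edge from inside the Jordan curve formed by the edge and the part of the exterior cycle
  between its ends (\<open>triangle_apex\<close>).

  Sharpness. Let \<open>q + 1\<close> gadgets on \<open>k + 4\<close> consecutive vertices each be joined in a row. The inner
  vertices of a gadget have no neighbours outside it and contain a star \<open>K\<^bsub>1,k+1\<^esub>\<close>, so an isolating
  set meets every gadget. To realise the model by a plane graph, vertex \<open>i\<close> is put at \<open>(i, i\<^sup>2)\<close> and
  edges are drawn straight; whether a point lies above or below a secant of the parabola is a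
  quadratic inequality, which makes all faces explicit (\<open>mop_G\<close>).
\<close>

section \<open>Small isolating sets of triangulated polygons\<close>

definition adj :: "('a \<times> 'a) set \<Rightarrow> 'a \<Rightarrow> 'a \<Rightarrow> bool" where
  "adj E u w \<longleftrightarrow> (u, w) \<in> E \<or> (w, u) \<in> E"

lemma adj_sym: "adj E u w \<longleftrightarrow> adj E w u"
  by (auto simp: adj_def)

definition undominated :: "'a set \<Rightarrow> ('a \<times> 'a) set \<Rightarrow> 'a set \<Rightarrow> 'a set" where
  "undominated V E S = {v \<in> V. v \<notin> S \<and> (\<forall>s\<in>S. \<not> adj E s v)}"

definition isolating :: "nat \<Rightarrow> 'a set \<Rightarrow> ('a \<times> 'a) set \<Rightarrow> 'a set \<Rightarrow> bool" where
  "isolating k V E S \<longleftrightarrow> S \<subseteq> V \<and>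
     (\<forall>u \<in> undominated V E S. card {w \<in> undominated V E S. adj E u w} \<le> k)"

text \<open>
  The order on the vertices is their order along the outer cycle, cut open at one edge, the root,
  which joins the first vertex to the last. Edges are pairs with the smaller end first. Every other
  edge of the outer cycle follows from \<open>root\<close> and \<open>apex\<close> by descending to smaller and smaller triangles.
\<close>

locale triangulated_polygon =
  fixes V :: "'a::linorder set" and E :: "('a \<times> 'a) set"
  assumes finite_V: "finite V"
    and edge_verts: "(a, b) \<in> E \<Longrightarrow> a \<in> V \<and> b \<in> V \<and> a < b"
    and root: "(Min V, Max V) \<in> E"
    and apex: "\<lbrakk>(a, b) \<in> E; v \<in> V; a < v; v < b\<rbrakk> \<Longrightarrow> \<exists>z. a < z \<and> z < b \<and> (a, z) \<in> E \<and> (z, b) \<in> E"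
    and noncrossing: "\<lbrakk>(a, b) \<in> E; (c, d) \<in> E; a < c; c < b\<rbrakk> \<Longrightarrow> d \<le> b"
begin

definition between :: "'a \<Rightarrow> 'a \<Rightarrow> 'a set" where
  "between a b = {v \<in> V. a < v \<and> v < b}"

lemma finite_between [simp]: "finite (between a b)"
  using finite_V by (simp add: between_def)

lemma Min_le_V: "v \<in> V \<Longrightarrow> Min V \<le> v" and Max_ge_V: "v \<in> V \<Longrightarrow> v \<le> Max V"
  using finite_V by auto

lemma card_between_split:
  assumes "(a, z) \<in> E" "(z, b) \<in> E"
  shows "card (between a b) = card (between a z) + card (between z b) + 1"
proof -
  have "between a b = insert z (between a z \<union> between z b)"
    using edge_verts[OF assms(1)] edge_verts[OF assms(2)] by (auto simp: between_def)
  moreover have "between a z \<inter> between z b = {}" "z \<notin> between a z \<union> between z b"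
    by (auto simp: between_def)
  ultimately show ?thesis by (simp add: card_Un_disjoint)
qed

lemma card_outer_split:
  assumes "(x, y) \<in> E"
  shows "card V = card (between x y) + card (V - between x y)"
        "card (V - between x y) = card (V - {x..y}) + 2"
proof -
  show "card V = card (between x y) + card (V - between x y)"
    using finite_V by (subst card_Un_disjoint[symmetric]) (auto simp: between_def intro: arg_cong[where f=card])
  have "V - between x y = insert x (insert y (V - {x..y}))"
    using edge_verts[OF assms] by (auto simp: between_def)
  then show "card (V - between x y) = card (V - {x..y}) + 2"
    using edge_verts[OF assms] finite_V by (auto simp: card_insert_if)
qed

lemma card_between_root: "card V = card (between (Min V) (Max V)) + 2"
proof -
  have "V - {Min V..Max V} = {}" using Min_le_V Max_ge_V by auto
  then have "card (V - {Min V..Max V}) = 0" by (simp only: card.empty)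
  then show ?thesis using card_outer_split[OF root] by linarith
qed

lemma adj_between:
  assumes "(x, y) \<in> E" "x < u" "u < y" "adj E u w"
  shows "x \<le> w" "w \<le> y"
  using assms noncrossing[of w u x y] noncrossing[of x y u w] noncrossing[of x y w u] edge_verts
  unfolding adj_def by (meson less_le_trans less_imp_le not_le order.strict_trans)+

lemma adj_verts: "adj E u w \<Longrightarrow> u \<in> V \<and> w \<in> V \<and> u \<noteq> w"
  using edge_verts by (force simp: adj_def)

lemma minimal_edge:
  assumes "c \<le> card (between (Min V) (Max V))"
  obtains x y where "(x, y) \<in> E" "c \<le> card (between x y)"
    "\<And>a b. \<lbrakk>(a, b) \<in> E; card (between a b) < card (between x y)\<rbrakk> \<Longrightarrow> card (between a b) < c"
proof -
  let ?P = "\<lambda>e. e \<in> E \<and> c \<le> card (between (fst e) (snd e))"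
  obtain e where e: "?P e" "\<forall>f. ?P f \<longrightarrow> card (between (fst e) (snd e)) \<le> card (between (fst f) (snd f))"
    using ex_has_least_nat[of ?P "(Min V, Max V)" "\<lambda>e. card (between (fst e) (snd e))"] root assms
    by auto
  show ?thesis
    by (rule that[of "fst e" "snd e"]) (use e in \<open>force+\<close>)
qed

lemma large_triangle:
  assumes "c \<le> card (between (Min V) (Max V))" "0 < c"
  obtains x y z where "(x, y) \<in> E" "(x, z) \<in> E" "(z, y) \<in> E"
    "c \<le> card (between x z) + card (between z y) + 1"
    "card (between x z) < c" "card (between z y) < c"
proof -
  obtain x y where xy: "(x, y) \<in> E" "c \<le> card (between x y)"
    "\<And>a b. \<lbrakk>(a, b) \<in> E; card (between a b) < card (between x y)\<rbrakk> \<Longrightarrow> card (between a b) < c"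
    using minimal_edge[OF assms(1)] by metis
  have "between x y \<noteq> {}" using xy(2) assms(2) by auto
  then obtain z where z: "(x, z) \<in> E" "(z, y) \<in> E"
    using apex[OF xy(1)] by (auto simp: between_def)
  show ?thesis
    by (rule that[OF xy(1) z]) (use xy(2,3) z card_between_split[OF z] in auto)
qed

text \<open>
  Every edge other than the root also has a triangle on its outer side: the triangle on the
  shortest edge that encloses it must have it as a side, because otherwise one of the other two sides
  of that triangle would be a shorter enclosing edge.
\<close>

lemma outer_apex:
  assumes "(x, y) \<in> E" "v \<in> V" "v < x \<or> y < v"
  obtains t where "t \<in> V" "t < x \<or> y < t" "adj E t x" "adj E t y"
proof -
  let ?P = "\<lambda>e. e \<in> E \<and> fst e \<le> x \<and> y \<le> snd e \<and> e \<noteq> (x, y)"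
  have "Min V \<le> x" "y \<le> Max V" "(Min V, Max V) \<noteq> (x, y)"
    using Min_le_V[of x] Max_ge_V[of y] Min_le_V[of v] Max_ge_V[of v] edge_verts[OF assms(1)] assms
    by auto
  then obtain e where e: "?P e" "\<forall>f. ?P f \<longrightarrow> card (between (fst e) (snd e)) \<le> card (between (fst f) (snd f))"
    using ex_has_least_nat[of ?P "(Min V, Max V)" "\<lambda>e. card (between (fst e) (snd e))"] root
    by (metis fst_conv snd_conv)
  obtain a b where ab: "e = (a, b)" by (cases e)
  have "\<exists>v. v \<in> V \<and> a < v \<and> v < b"
    using e(1) edge_verts[OF assms(1)] unfolding ab by (auto simp: order_le_less)
  then obtain z where z: "a < z" "z < b" "(a, z) \<in> E" "(z, b) \<in> E"
    using apex[of a b] e(1) ab by auto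
  have small: "card (between a z) < card (between a b)" "card (between z b) < card (between a b)"
    using card_between_split[OF z(3,4)] by auto
  have "y \<le> z \<or> z \<le> x"
    using noncrossing[of x y z b] z e(1) ab assms(1) edge_verts[OF assms(1)]
      noncrossing[of a z x y] by (metis fst_conv snd_conv less_le_trans not_le order_le_less)
  then show ?thesis
  proof
    assume yz: "y \<le> z"
    then have "(a, z) = (x, y)" using e small z(3) ab by (force simp: not_le[symmetric])
    then show ?thesis using that[of b] z e(1) ab edge_verts[of z b] by (auto simp: adj_def)
  next
    assume "z \<le> x"
    then have "(z, b) = (x, y)" using e small z(4) ab by (force simp: not_le[symmetric])
    then show ?thesis using that[of a] z e(1) ab edge_verts[of a z] by (auto simp: adj_def)
  qed
qed

lemma degree_bound:
  assumes "finite R" "u \<in> R" "card R \<le> Suc k" "\<And>w. \<lbrakk>w \<in> W; adj E u w\<rbrakk> \<Longrightarrow> w \<in> R"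
  shows "card {w \<in> W. adj E u w} \<le> k"
proof -
  have "{w \<in> W. adj E u w} \<subseteq> R - {u}"
    using assms(4) adj_verts by auto
  then have "card {w \<in> W. adj E u w} \<le> card (R - {u})"
    using assms(1) by (intro card_mono) auto
  then show ?thesis using assms by simp
qed

text \<open>
  In the applications \<open>W\<close> is the set of undominated vertices. One vertex more is affordable between the ends
  if one end has no neighbour in \<open>W\<close>, since that end is adjacent to the apex over \<open>(a, b)\<close>.
\<close>

lemma degree_between:
  assumes "(a, b) \<in> E" "a \<notin> W" "b \<notin> W" "W \<subseteq> V" "u \<in> W" "a < u" "u < b"
    and "card (between a b) \<le> Suc k \<or>
      card (between a b) \<le> Suc (Suc k) \<and> (\<forall>t. adj E a t \<longrightarrow> t \<notin> W) \<or>
      card (between a b) \<le> Suc (Suc k) \<and> (\<forall>t. adj E b t \<longrightarrow> t \<notin> W)"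
  shows "card {w \<in> W. adj E u w} \<le> k"
proof (rule degree_bound[where R = "between a b \<inter> W"])
  show "u \<in> between a b \<inter> W" using assms by (auto simp: between_def)
  show "w \<in> between a b \<inter> W" if "w \<in> W" "adj E u w" for w
    using adj_between[OF assms(1,6,7) that(2)] assms(2-4) that(1) by (auto simp: between_def order_le_less)
  obtain z where z: "a < z" "z < b" "(a, z) \<in> E" "(z, b) \<in> E"
    using apex[OF assms(1)] assms by blast
  have "z \<in> between a b" using z edge_verts by (auto simp: between_def)
  have 1: "card (between a b \<inter> W) \<le> card (between a b)" by (intro card_mono) auto
  have 2: "card (between a b \<inter> W) \<le> card (between a b) - 1" if "z \<notin> W"
  proof -
    have "card (between a b \<inter> W) \<le> card (between a b - {z})" using that by (intro card_mono) auto
    then show ?thesis using \<open>z \<in> between a b\<close> by simp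
  qed
  show "card (between a b \<inter> W) \<le> Suc k"
  proof (cases "card (between a b) \<le> Suc k")
    case True
    then show ?thesis using 1 by simp
  next
    case False
    then have "card (between a b) \<le> Suc (Suc k)"
      and "(\<forall>t. adj E a t \<longrightarrow> t \<notin> W) \<or> (\<forall>t. adj E b t \<longrightarrow> t \<notin> W)"
      using assms(8) by blast+
    moreover have "adj E a z" "adj E b z" using z(3,4) by (simp_all add: adj_def)
    ultimately have "z \<notin> W" and "card (between a b) \<le> Suc (Suc k)" by blast+
    then show ?thesis using 2 by simp
  qed
qed simp

text \<open>
  The corner \<open>v\<close> settles the region behind a side that ends in it even if \<open>k + 2\<close> vertices lie there.
\<close>

lemma degree_under_triangle:
  assumes "(x, z) \<in> E" "(z, y) \<in> E"
    and W: "W \<subseteq> V" "x \<notin> W" "y \<notin> W" "z \<notin> W" "\<And>t. adj E v t \<Longrightarrow> t \<notin> W"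
    and small: "card (between x z) \<le> k + 2" "card (between z y) \<le> k + 2"
    and v1: "card (between x z) \<le> k + 1 \<or> v \<in> {x, z}"
    and v2: "card (between z y) \<le> k + 1 \<or> v \<in> {z, y}"
    and u: "u \<in> W" "x < u" "u < y"
  shows "card {w \<in> W. adj E u w} \<le> k"
proof -
  have "u \<noteq> z" using u W by auto
  then consider "x < u" "u < z" | "z < u" "u < y" using u by (auto simp: neq_iff)
  then show ?thesis
  proof cases
    case 1
    have "card (between x z) \<le> Suc k \<or> (\<forall>t. adj E x t \<longrightarrow> t \<notin> W) \<or> (\<forall>t. adj E z t \<longrightarrow> t \<notin> W)"
      using v1
    proof
      assume "v \<in> {x, z}"
      then show ?thesis using W(5) by blast
    qed simp
    moreover have "card (between x z) \<le> Suc (Suc k)" using small by simp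
    ultimately show ?thesis
      by (intro degree_between[OF assms(1) W(2,4,1) u(1) 1]) blast
  next
    case 2
    have "card (between z y) \<le> Suc k \<or> (\<forall>t. adj E z t \<longrightarrow> t \<notin> W) \<or> (\<forall>t. adj E y t \<longrightarrow> t \<notin> W)"
      using v2
    proof
      assume "v \<in> {z, y}"
      then show ?thesis using W(5) by blast
    qed simp
    moreover have "card (between z y) \<le> Suc (Suc k)" using small by simp
    ultimately show ?thesis
      by (intro degree_between[OF assms(2) W(4,3,1) u(1) 2]) blast
  qed
qed

text \<open>
  Around the triangle \<open>x, z, y\<close> there are three regions of at most \<open>k + 2\<close> vertices, with at most
  \<open>2k + 4\<close> vertices in total. A corner copes with \<open>k + 2\<close> vertices behind each of its two sides, so it
  only needs at most \<open>k + 1\<close> vertices behind the opposite side, and the smallest region satisfies this.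
\<close>

lemma one_vertex_isolating:
  assumes "card V \<le> 2 * k + 7"
  shows "\<exists>v\<in>V. isolating k V E {v}"
proof (cases "card (between (Min V) (Max V)) \<le> k + 2")
  case True
  let ?v = "Min V" and ?W = "undominated V E {Min V}"
  have W: "?W \<subseteq> V" "Min V \<notin> ?W" "Max V \<notin> ?W" "\<And>t. adj E (Min V) t \<Longrightarrow> t \<notin> ?W"
    using root by (auto simp: undominated_def adj_def)
  have "card {w \<in> ?W. adj E u w} \<le> k" if "u \<in> ?W" for u
    by (rule degree_between[OF root W(2,3,1) that])
       (use that W True Min_le_V[of u] Max_ge_V[of u] in \<open>force simp: order_le_less\<close>)+
  then show ?thesis using edge_verts[OF root] by (auto simp: isolating_def)
next
  case False
  obtain x y z where xyz: "(x, y) \<in> E" "(x, z) \<in> E" "(z, y) \<in> E"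
    and c: "k + 3 \<le> card (between x z) + card (between z y) + 1"
      "card (between x z) < k + 3" "card (between z y) < k + 3"
    by (rule large_triangle[of "k + 3"]) (use False in auto)
  have V: "x \<in> V" "y \<in> V" "z \<in> V" "x < z" "z < y" "x < y" using xyz edge_verts by auto
  have out: "card (between x z) + card (between z y) + card (V - {x..y}) \<le> 2 * k + 4"
    using card_outer_split[OF xyz(1)] card_between_split[OF xyz(2,3)] assms by linarith
  \<comment> \<open>The corner opposite a region with at most \<open>k + 1\<close> vertices. If only the outer region has so
    few, both inner regions have \<open>k + 2\<close> vertices and the outer one is empty.\<close>
  obtain v where v: "v \<in> {x, y, z}"
    and v1: "card (between x z) \<le> k + 1 \<or> v \<in> {x, z}"
    and v2: "card (between z y) \<le> k + 1 \<or> v \<in> {z, y}"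
    and v3: "card (V - {x..y}) \<le> k + 1 \<or> card (V - {x..y}) \<le> k + 2 \<and> v \<in> {x, y}"
  proof (cases "card (between x z) \<le> k + 1")
    case True
    then show ?thesis using that[of y] out c by auto
  next
    case False
    note F = this
    show ?thesis
    proof (cases "card (between z y) \<le> k + 1")
      case True
      then show ?thesis using that[of x] out c by auto
    next
      case False
      then show ?thesis using that[of z] out c F by auto
    qed
  qed
  let ?W = "undominated V E {v}"
  have W: "?W \<subseteq> V" "x \<notin> ?W" "y \<notin> ?W" "z \<notin> ?W" "\<And>t. adj E v t \<Longrightarrow> t \<notin> ?W"
    using v xyz by (auto simp: undominated_def adj_def)
  have "card {w \<in> ?W. adj E u w} \<le> k" if u: "u \<in> ?W" for u
  proof -
    consider "x < u" "u < y" | "u < x \<or> y < u"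
      using u W by (metis linorder_neqE)
    then show ?thesis
    proof cases
      case 1
      then show ?thesis
        using degree_under_triangle[OF xyz(2,3) W _ _ v1 v2 u] c by simp
    next
      case 2
      obtain t where t: "t \<in> V" "t < x \<or> y < t" "adj E t x" "adj E t y"
        using outer_apex[OF xyz(1)] 2 u W(1) by blast
      show ?thesis
      proof (rule degree_bound[where R = "(V - {x..y}) \<inter> ?W"])
        show "u \<in> (V - {x..y}) \<inter> ?W" using 2 u W(1) by auto
        show "w \<in> (V - {x..y}) \<inter> ?W" if "w \<in> ?W" "adj E u w" for w
          using adj_between[OF xyz(1), of w u] that 2 W by (force simp: adj_sym order_le_less)
        have all: "card ((V - {x..y}) \<inter> ?W) \<le> card (V - {x..y})"
          using finite_V by (intro card_mono) auto
        have but_t: "card ((V - {x..y}) \<inter> ?W) \<le> card (V - {x..y}) - 1" if "v \<in> {x, y}"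
        proof -
          have "t \<notin> ?W" using W(5)[of t] t that by (auto simp: adj_sym)
          then have "card ((V - {x..y}) \<inter> ?W) \<le> card ((V - {x..y}) - {t})"
            using finite_V by (intro card_mono) auto
          also have "\<dots> = card (V - {x..y}) - 1" by (rule card_Diff_singleton) (use t in auto)
          finally show ?thesis .
        qed
        show "card ((V - {x..y}) \<inter> ?W) \<le> Suc k"
          using v3 all but_t by fastforce
      qed (use finite_V in auto)
    qed
  qed
  then show ?thesis using v V by (auto simp: isolating_def)
qed

text \<open>
  The only edge that can lose its apex is \<open>(x, y)\<close> itself, and nothing is left between its ends.
\<close>

lemma cut_off:
  assumes "(x, y) \<in> E"
  shows "triangulated_polygon (V - between x y) {(a, b) \<in> E. a \<notin> between x y \<and> b \<notin> between x y}"
proof (unfold_locales, goal_cases)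
  case 3
  have xy: "x \<in> V" "y \<in> V" "x < y" using edge_verts[OF assms] by auto
  have "Min V \<in> V - between x y" "Max V \<in> V - between x y"
    using edge_verts[OF root] Min_le_V[OF xy(1)] Max_ge_V[OF xy(2)] by (auto simp: between_def)
  moreover from this have "Min (V - between x y) = Min V" "Max (V - between x y) = Max V"
    using finite_V by (auto intro!: Min_eqI Max_eqI)
  ultimately show ?case using root by auto
next
  case (4 a b v)
  then have ab: "(a, b) \<in> E" "a \<in> V" "b \<in> V" "a < b" using edge_verts by auto
  obtain z where z: "a < z" "z < b" "(a, z) \<in> E" "(z, b) \<in> E"
    using apex[of a b v] 4 by auto
  have xy: "x \<in> V" "y \<in> V" "x < y" using edge_verts[OF assms] by auto
  show ?case
  proof (cases "z \<in> between x y")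
    case False
    then show ?thesis using z 4 by auto
  next
    case True
    then have "x \<le> a" "b \<le> y"
      using adj_between[OF assms, of z a] adj_between[OF assms, of z b] z by (auto simp: between_def adj_def)
    then have "a = x" "b = y" using 4 ab z True by (auto simp: between_def)
    then show ?thesis using 4 by (auto simp: between_def)
  qed
next
  case (5 a b c d)
  then show ?case using noncrossing by auto
qed (use finite_V edge_verts in auto)

text \<open>
  The ends of an edge with nothing between them are neighbours in the order, so identifying them is a
  monotone map. Monotonicity carries over all conditions but the apex.
\<close>

lemma contract:
  assumes "(x, y) \<in> E" "between x y = {}" "3 \<le> card V"
  defines "f \<equiv> \<lambda>v. if v = y then x else v"
  shows "triangulated_polygon (V - {y}) {(f a, f b) | a b. (a, b) \<in> E \<and> f a \<noteq> f b}"
proof -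
  have xy: "x \<in> V" "y \<in> V" "x < y" using edge_verts[OF assms(1)] by auto
  have mono: "f u \<le> f v" if "u \<le> v" "u \<in> V" for u v
    using that xy assms(2) unfolding f_def between_def by (auto simp: not_le not_less)
  have smono: "u < v" if "f u < f v" "u \<in> V" "v \<in> V" for u v
    using mono[of v u] that by (meson leD not_le_imp_less)
  have f_V: "f v \<in> V - {y}" if "v \<in> V" for v using that xy by (auto simp: f_def)
  have f_id: "f v = v" if "v \<in> V - {y}" for v using that by (auto simp: f_def)
  have f_eq: "{u, v} = {x, y} \<or> u = v" if "f u = f v" for u v
    using that by (auto simp: f_def split: if_splits)
  show ?thesis
  proof (unfold_locales, goal_cases)
    case 1 show ?case using finite_V by simp
  next
    case (2 a b)
    then obtain a' b' where ab: "a = f a'" "b = f b'" "(a', b') \<in> E" "f a' \<noteq> f b'" by auto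
    then show ?case using edge_verts[of a' b'] f_V mono[of a' b'] by (auto simp: order_le_less)
  next
    case 3
    have mM: "Min V \<in> V" "Max V \<in> V" using edge_verts[OF root] by auto
    have "Min (V - {y}) = f (Min V)"
      using finite_V f_V[OF mM(1)] mono[OF Min_le_V] f_id mM by (intro Min_eqI) (auto, metis)
    moreover have "Max (V - {y}) = f (Max V)"
      using finite_V f_V[OF mM(2)] mono[OF Max_ge_V] f_id mM by (intro Max_eqI) (auto, metis)
    moreover have "f (Min V) \<noteq> f (Max V)"
    proof
      assume "f (Min V) = f (Max V)"
      with f_eq[OF this] edge_verts[OF root] xy have "Min V = x" "Max V = y"
        by (auto simp: doubleton_eq_iff)
      then show False using card_between_root assms(2,3) by simp
    qed
    ultimately show ?case using root by auto
  next
    case (4 a b v)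
    then obtain a' b' where ab: "a = f a'" "b = f b'" "(a', b') \<in> E" "f a' \<noteq> f b'" by auto
    \<comment> \<open>If the apex over \<open>(a', b')\<close> is identified with an end of this edge, then one side of the
      triangle is the contracted edge. The other side has the same image as \<open>(a', b')\<close>, and the apex
      over it is used instead.\<close>
    have "\<exists>z. f a' < f z \<and> f z < f b' \<and> (\<exists>a'' b''. f a'' = f a' \<and> f b'' = f b' \<and> (a'', z) \<in> E \<and> (z, b'') \<in> E)"
    proof -
      have lift: "\<exists>z. (a'', z) \<in> E \<and> (z, b'') \<in> E" if "(a'', b'') \<in> E" "f a'' = f a'" "f b'' = f b'" for a'' b''
      proof -
        have "a'' < v" "v < b''"
          using smono[of a'' v] smono[of v b''] 4 that ab f_id[of v] edge_verts[OF that(1)] by auto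
        then show ?thesis using apex[OF that(1), of v] 4 by auto
      qed
      obtain z where z: "(a', z) \<in> E" "(z, b') \<in> E" using lift[OF ab(3)] by auto
      have le: "f a' \<le> f z" "f z \<le> f b'" using z edge_verts mono by (meson order_less_imp_le)+
      consider "f z \<noteq> f a'" "f z \<noteq> f b'" | "f z = f a'" | "f z = f b'" by auto
      then show ?thesis
      proof cases
        case 1
        then show ?thesis using z le by (intro exI[of _ z]) (auto simp: order_le_less)
      next
        case 2
        then have "a' = x" "z = y" using f_eq[of z a'] edge_verts[OF z(1)] xy by (auto simp: doubleton_eq_iff)
        obtain t where t: "(z, t) \<in> E" "(t, b') \<in> E" using lift[OF z(2)] 2 by auto
        have "f a' < f t" "f t < f b'"
          using edge_verts[OF t(1)] edge_verts[OF t(2)] \<open>a' = x\<close> \<open>z = y\<close> xy by (auto simp: f_def)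
        then show ?thesis using t 2 by auto
      next
        case 3
        then have *: "z = x" "b' = y" using f_eq[of z b'] edge_verts[OF z(2)] xy by (auto simp: doubleton_eq_iff)
        obtain t where t: "(a', t) \<in> E" "(t, z) \<in> E" using lift[OF z(1)] 3 by auto
        have "f a' < f t" "f t < f b'"
          using edge_verts[OF t(1)] edge_verts[OF t(2)] * xy by (auto simp: f_def)
        then show ?thesis using t 3 by auto
      qed
    qed
    then obtain z a'' b'' where z: "f a' < f z" "f z < f b'" "f a'' = f a'" "f b'' = f b'"
      "(a'', z) \<in> E" "(z, b'') \<in> E" by blast
    then have "f a'' \<noteq> f z" "f z \<noteq> f b''" by auto
    then have "(f a'', f z) \<in> {(f a, f b) | a b. (a, b) \<in> E \<and> f a \<noteq> f b}"
      "(f z, f b'') \<in> {(f a, f b) | a b. (a, b) \<in> E \<and> f a \<noteq> f b}"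
      using z(5,6) by blast+
    then show ?case unfolding ab using z by auto
  next
    case (5 a b c d)
    then obtain a' b' c' d' where *: "a = f a'" "b = f b'" "(a', b') \<in> E" "c = f c'" "d = f d'" "(c', d') \<in> E"
      by auto
    have "a' < c'" "c' < b'"
      using smono[of a' c'] smono[of c' b'] 5 * edge_verts by metis+
    from noncrossing[OF *(3,6) this] show ?case using mono * edge_verts by blast
  qed
qed

end

lemma card_insert_le_Suc: "card (insert v S) \<le> card S + 1"
  by (cases "finite S") (auto simp: card_insert_if)

lemma image_edgeI:
  assumes "f a = a" "f b = b" "a \<noteq> b" "(a, b) \<in> F"
  shows "(a, b) \<in> {(f a, f b) | a b. (a, b) \<in> F \<and> f a \<noteq> f b}"
proof -
  have "(a, b) = (f a, f b) \<and> (a, b) \<in> F \<and> f a \<noteq> f b" using assms by simp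
  then show ?thesis by blast
qed

text \<open>
  The maximum with 1 lets the induction hypothesis apply to every smaller polygon, however small: in
  the induction step there are at least \<open>2 (k + 4)\<close> vertices, so that two vertices are always affordable.
\<close>

lemma exists_small_isolating:
  assumes "triangulated_polygon V E"
  shows "\<exists>S. isolating k V E S \<and> card S \<le> max 1 (card V div (k + 4))"
  using assms
proof (induction "card V" arbitrary: V E rule: less_induct)
  case less
  interpret triangulated_polygon V E by fact
  show ?case
  proof (cases "card V \<le> 2 * k + 7")
    case True
    then obtain v where "isolating k V E {v}" using one_vertex_isolating by blast
    then show ?thesis by (intro exI[of _ "{v}"]) auto
  next
    case False
    then have big: "2 * k + 8 \<le> card V" by simp
    \<comment> \<open>One more vertex is paid for by the loss of \<open>k + 4\<close> vertices.\<close>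
    have div: "max 1 (n' div (k + 4)) + 1 \<le> max 1 (card V div (k + 4))" if "n' + (k + 4) \<le> card V" for n'
    proof -
      have "(2 * (k + 4)) div (k + 4) \<le> card V div (k + 4)"
        using big by (intro div_le_mono) simp
      moreover have "(n' + (k + 4)) div (k + 4) \<le> card V div (k + 4)"
        using that by (intro div_le_mono)
      moreover have "(n' + (k + 4)) div (k + 4) = n' div (k + 4) + 1" by (rule div_add_self2) simp
      moreover have "(2 * (k + 4)) div (k + 4) = 2" by (rule nonzero_mult_div_cancel_right) simp
      ultimately show ?thesis by linarith
    qed
    obtain x y z where xyz: "(x, y) \<in> E" "(x, z) \<in> E" "(z, y) \<in> E"
      and c: "k + 3 \<le> card (between x z) + card (between z y) + 1"
        "card (between x z) < k + 3" "card (between z y) < k + 3"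
      by (rule large_triangle[of "k + 3"]) (use big card_between_root in auto)
    have V: "x \<in> V" "y \<in> V" "z \<in> V" "x < z" "z < y" "x < y" using xyz edge_verts by auto
    have cV: "card V = card (between x z) + card (between z y) + 1 + card (V - between x y)"
      using card_outer_split(1)[OF xyz(1)] card_between_split[OF xyz(2,3)] by simp
    let ?V1 = "V - between x y"
    let ?E1 = "{(a, b) \<in> E. a \<notin> between x y \<and> b \<notin> between x y}"
    have tri1: "triangulated_polygon ?V1 ?E1" by (rule cut_off) fact
    \<comment> \<open>Both reductions are justified in the same way. The corner \<open>v\<close> handles the vertices between \<open>x\<close>
      and \<open>y\<close>; for the others, domination by \<open>S'\<close> and adjacency in the smaller polygon decide.\<close>
    have combine: "isolating k V E S"
      if "S \<subseteq> V" and v: "v \<in> S" "v \<in> {x, y, z}"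
        and v1: "card (between x z) \<le> k + 1 \<or> v \<in> {x, z}"
        and v2: "card (between z y) \<le> k + 1 \<or> v \<in> {z, y}"
        and S': "isolating k V' E' S'"
        and out: "\<And>u. \<lbrakk>u \<in> undominated V E S; u < x \<or> y < u\<rbrakk> \<Longrightarrow> u \<in> undominated V' E' S'"
        and E': "\<And>u w. \<lbrakk>adj E u w; u < x \<or> y < u; w < x \<or> y < w\<rbrakk> \<Longrightarrow> adj E' u w" and "finite V'"
      for S S' v V' E'
    proof -
      let ?W = "undominated V E S"
      have W: "?W \<subseteq> V" "x \<notin> ?W" "y \<notin> ?W" "z \<notin> ?W" "\<And>t. adj E v t \<Longrightarrow> t \<notin> ?W"
        using v xyz by (auto simp: undominated_def adj_def)
      have "card {w \<in> ?W. adj E u w} \<le> k" if u: "u \<in> ?W" for u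
      proof -
        consider "x < u" "u < y" | "u < x \<or> y < u"
          using u W by (metis linorder_neqE)
        then show ?thesis
        proof cases
          case 1
          then show ?thesis
            using degree_under_triangle[OF xyz(2,3) W _ _ v1 v2 u] c by simp
        next
          case 2
          have "w < x \<or> y < w" if w: "w \<in> ?W" "adj E u w" for w
          proof (rule ccontr)
            assume "\<not> (w < x \<or> y < w)"
            then have "x < w" "w < y" using w(1) W(2,3) by (auto simp: not_less order_le_less)
            from adj_between[OF xyz(1) this, of u] have "x \<le> u" "u \<le> y" using w(2) by (auto simp: adj_sym)
            then show False using 2 by auto
          qed
          then have "{w \<in> ?W. adj E u w} \<subseteq> {w \<in> undominated V' E' S'. adj E' u w}"
            using out E' 2 by blast
          moreover have "finite {w \<in> undominated V' E' S'. adj E' u w}"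
            using \<open>finite V'\<close> by (auto simp: undominated_def)
          ultimately have "card {w \<in> ?W. adj E u w} \<le> card {w \<in> undominated V' E' S'. adj E' u w}"
            by (rule card_mono[rotated])
          also have "\<dots> \<le> k" using S' out[OF u 2] by (auto simp: isolating_def)
          finally show ?thesis .
        qed
      qed
      then show ?thesis using \<open>S \<subseteq> V\<close> by (auto simp: isolating_def)
    qed
    show ?thesis
    proof (cases "card (between x z) = k + 2 \<and> card (between z y) = k + 2")
      case True
      have "card ?V1 + (k + 4) \<le> card V" "card ?V1 < card V" using cV True by auto
      then obtain S' where S': "isolating k ?V1 ?E1 S'" "card S' \<le> max 1 (card ?V1 div (k + 4))"
        using less.hyps[OF _ tri1] by auto
      have "isolating k V E (insert z S')"
        by (rule combine[where v = z, OF _ _ _ _ _ S'(1)])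
           (use S'(1) V finite_V in \<open>auto simp: isolating_def undominated_def adj_def between_def\<close>)
      moreover have "card (insert z S') \<le> max 1 (card V div (k + 4))"
        using div[OF \<open>card ?V1 + (k + 4) \<le> card V\<close>] S'(2) card_insert_le_Suc[of z S'] by linarith
      ultimately show ?thesis by blast
    next
      case False
      \<comment> \<open>Here some corner \<open>v\<close> among \<open>x\<close> and \<open>y\<close> suffices. At least \<open>k + 3\<close> vertices lie between them,
        and the contraction removes one more.\<close>
      define f where "f = (\<lambda>v. if v = y then x else v)"
      let ?V2 = "?V1 - {y}" and ?E2 = "{(f a, f b) | a b. (a, b) \<in> ?E1 \<and> f a \<noteq> f b}"
      have xy1: "(x, y) \<in> ?E1" using xyz by (auto simp: between_def)
      have "triangulated_polygon.between ?V1 x y = {}"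
        unfolding triangulated_polygon.between_def[OF tri1] by (auto simp: between_def)
      then have tri2: "triangulated_polygon ?V2 ?E2"
        using triangulated_polygon.contract[OF tri1 xy1] cV c big unfolding f_def by simp
      have "card ?V1 = Suc (card ?V2)"
        using finite_V V by (intro card.remove) (auto simp: between_def)
      then have "card ?V2 + (k + 4) \<le> card V" "card ?V2 < card V"
        using cV c by linarith+
      then obtain S' where S': "isolating k ?V2 ?E2 S'" "card S' \<le> max 1 (card ?V2 div (k + 4))"
        using less.hyps[OF _ tri2] by auto
      define v where "v = (if card (between z y) \<le> k + 1 then x else y)"
      \<comment> \<open>If the contracted vertex \<open>x\<close> is in \<open>S'\<close>, both \<open>x\<close> and \<open>y\<close> are taken: together they dominate
        whatever the contracted vertex dominates, and one of them is \<open>v\<close>.\<close>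
      define v' where "v' = (if x \<in> S' then y else v)"
      have xy_S: "x \<in> S' \<Longrightarrow> x \<in> insert v' S' \<and> y \<in> insert v' S'" by (auto simp: v'_def)
      have E2: "adj E s u" if "adj ?E2 s u" "s \<noteq> x" "u < x \<or> y < u" for s u
        using that V by (auto simp: adj_def f_def split: if_splits)
      have E2x: "adj E x u \<or> adj E y u" if "adj ?E2 x u" "u < x \<or> y < u" for u
        using that V by (auto simp: adj_def f_def split: if_splits)
      have "isolating k V E (insert v' S')"
      proof (rule combine[where v = v, OF _ _ _ _ _ S'(1)])
        show "insert v' S' \<subseteq> V" using S'(1) V by (auto simp: isolating_def v'_def v_def)
        show "v \<in> insert v' S'" "v \<in> {x, y, z}" by (auto simp: v'_def v_def)
        show "card (between x z) \<le> k + 1 \<or> v \<in> {x, z}" "card (between z y) \<le> k + 1 \<or> v \<in> {z, y}"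
          using False c by (auto simp: v_def)
        show "u \<in> undominated ?V2 ?E2 S'" if u: "u \<in> undominated V E (insert v' S')" "u < x \<or> y < u" for u
        proof -
          have "\<not> adj ?E2 s u" if "s \<in> S'" for s
            using E2[of s u] E2x[of u] u xy_S that by (cases "s = x") (auto simp: undominated_def)
          then show ?thesis using u V by (auto simp: undominated_def between_def)
        qed
        have image: "(a, b) \<in> ?E2"
          if "(a, b) \<in> E" "a < x \<or> y < a" "b < x \<or> y < b" for a b
        proof -
          have "f a = a" "f b = b" "a \<noteq> b" "(a, b) \<in> ?E1"
            using that V edge_verts[OF that(1)] by (auto simp: f_def between_def)
          then show ?thesis by (intro image_edgeI)
        qed
        show "adj ?E2 u w" if "adj E u w" "u < x \<or> y < u" "w < x \<or> y < w" for u w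
          using that(1) image[OF _ that(2,3)] image[OF _ that(3,2)] unfolding adj_def by (elim disjE) simp_all
      qed (use finite_V in auto)
      moreover have "card (insert v' S') \<le> max 1 (card V div (k + 4))"
        using div[OF \<open>card ?V2 + (k + 4) \<le> card V\<close>] S'(2) card_insert_le_Suc[of v' S'] by linarith
      ultimately show ?thesis by blast
    qed
  qed
qed

section \<open>The chords of a mop form a triangulated polygon\<close>

lemma arc_image_subset_closure_interior:
  assumes "arc g"
  shows "path_image g \<subseteq> closure (path_image g - {pathstart g, pathfinish g})"
proof -
  have "g ` closure {0<..<1::real} \<subseteq> closure (g ` {0<..<1})"
    using assms by (intro image_closure_subset) (auto simp: arc_def path_def intro: closure_subset[THEN subsetD])
  then show ?thesis
    using simple_path_endless[of g] assms by (simp add: path_image_def arc_imp_simple_path)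
qed

lemma unbounded_connected_subset_outside:
  assumes "connected X" "\<not> bounded X" "X \<inter> D = {}"
  shows "X \<subseteq> outside D"
proof
  fix x assume "x \<in> X"
  then have "X \<subseteq> connected_component_set (- D) x"
    using assms by (intro connected_component_maximal) auto
  then show "x \<in> outside D"
    using assms(2) bounded_subset by (auto simp: outside)
qed

lemma cycle_edges_eq_image:
  "cycle_edges p = (\<lambda>t. {p ! t, p ! (Suc t mod length p)}) ` {..<length p}"
  unfolding cycle_edges_def by auto

lemma finite_edges: "plane G \<Longrightarrow> finite (edges G)"
  by (rule finite_subset[of _ "Pow (verts G)"]) (auto simp: plane_def simple_graph_def)

abbreviation edge_image :: "plane_graph \<Rightarrow> complex set \<Rightarrow> complex set" where
  "edge_image G e \<equiv> path_image (curve G e)"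

context
  fixes G assumes plane: "plane G"
begin

lemma edge_ends: "{u, v} \<in> edges G \<Longrightarrow> u \<noteq> v \<and> u \<in> verts G \<and> v \<in> verts G"
proof -
  assume "{u, v} \<in> edges G"
  then have "{u, v} \<subseteq> verts G" "card {u, v} = 2"
    using plane by (auto simp: plane_def simple_graph_def)
  then show ?thesis by (cases "u = v") auto
qed

lemma edge_subset_verts: "e \<in> edges G \<Longrightarrow> e \<subseteq> verts G"
  using plane by (auto simp: plane_def simple_graph_def)

lemma edge_image_props:
  assumes "e \<in> edges G"
  shows "arc (curve G e)" "{pathstart (curve G e), pathfinish (curve G e)} = e"
    "e \<subseteq> edge_image G e" "edge_image G e \<subseteq> support G" "verts G \<inter> edge_image G e \<subseteq> e"
proof -
  show 1: "arc (curve G e)" "{pathstart (curve G e), pathfinish (curve G e)} = e"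
    using plane assms by (auto simp: plane_def)
  show "e \<subseteq> edge_image G e"
    using 1(2) pathstart_in_path_image[of "curve G e"] pathfinish_in_path_image[of "curve G e"]
    by (metis empty_subsetI insert_subset)
  show "edge_image G e \<subseteq> support G" using assms by (auto simp: support_def)
  show "verts G \<inter> edge_image G e \<subseteq> e" using plane assms by (auto simp: plane_def)
qed

lemma edge_images_meet:
  assumes "e \<in> edges G" "f \<in> edges G" "e \<noteq> f"
  shows "edge_image G e \<inter> edge_image G f \<subseteq> e \<inter> f"
proof -
  have "(edge_image G e - e) \<inter> edge_image G f = {}" "(edge_image G f - f) \<inter> edge_image G e = {}"
    using plane assms unfolding plane_def by metis+
  then show ?thesis by blast
qed

lemma oriented_curve:
  assumes "{u, v} \<in> edges G"
  obtains g where "arc g" "pathstart g = u" "pathfinish g = v" "path_image g = edge_image G {u, v}"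
proof -
  note e = edge_image_props[OF assms]
  consider "pathstart (curve G {u,v}) = u" "pathfinish (curve G {u,v}) = v"
    | "pathstart (curve G {u,v}) = v" "pathfinish (curve G {u,v}) = u"
    using e(2) by (auto simp: doubleton_eq_iff)
  then show ?thesis
  proof cases
    case 1 then show ?thesis using that e by blast
  next
    case 2 then show ?thesis
      using that[of "reversepath (curve G {u,v})"] e by (simp add: arc_reversepath)
  qed
qed

lemma edge_interior_point:
  assumes "e \<in> edges G" obtains q where "q \<in> edge_image G e - e"
proof -
  note e = edge_image_props[OF assms]
  have "edge_image G e - e \<noteq> {}"
    using nonempty_simple_path_endless[of "curve G e"] e(1,2) by (auto simp: arc_imp_simple_path)
  then show ?thesis using that by blast
qed

text \<open>
  The other edges and the vertices form a closed set that misses the interior of \<open>e\<close>.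
\<close>

lemma edge_interior_isolated:
  assumes "e \<in> edges G" "q \<in> edge_image G e - e"
  obtains r where "r > 0" "ball q r \<inter> support G \<subseteq> edge_image G e - e"
proof -
  define K where "K = verts G \<union> (\<Union>f \<in> edges G - {e}. edge_image G f)"
  have "closed K"
    unfolding K_def using plane finite_edges[OF plane] edge_image_props(1)
    by (intro closed_Un closed_UN finite_imp_closed)
       (auto simp: plane_def simple_graph_def intro!: closed_arc_image)
  moreover have "q \<notin> K"
    using assms edge_image_props(5)[OF assms(1)] edge_images_meet[OF assms(1)] by (auto simp: K_def)
  ultimately obtain r where r: "r > 0" "ball q r \<subseteq> - K"
    using open_contains_ball[of "- K"] by auto
  show ?thesis
  proof (rule that[OF r(1)])
    show "ball q r \<inter> support G \<subseteq> edge_image G e - e"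
      using r(2) edge_subset_verts[OF assms(1)] by (fastforce simp: support_def K_def)
  qed
qed

text \<open>
  Every inner point \<open>q\<close> of \<open>e\<close> is a limit of points inside the Jordan curve. Close to \<open>q\<close> such a point lies
  in a face, and moving straight on to \<open>q\<close> one leaves this face through a point of \<open>e\<close>.
\<close>

lemma face_inside_at_edge:
  assumes D: "simple_path g" "pathfinish g = pathstart g" "path_image g \<subseteq> support G"
    and e: "e \<in> edges G" "edge_image G e \<subseteq> path_image g"
  obtains F y where "F \<in> faces G" "bounded F" "F \<subseteq> inside (path_image g)"
    "y \<in> frontier F" "y \<in> edge_image G e - e"
proof -
  let ?R = "inside (path_image g)"
  note J = Jordan_inside_outside[OF D(1,2)]
  obtain q where q: "q \<in> edge_image G e - e" using edge_interior_point e(1) by blast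
  obtain r where r: "r > 0" "ball q r \<inter> support G \<subseteq> edge_image G e - e"
    using edge_interior_isolated[OF e(1) q] by blast
  have "q \<in> closure ?R" using q e(2) J by (auto simp: frontier_def)
  then obtain x where x: "x \<in> ?R" "x \<in> ball q r"
    using r(1) by (auto simp: closure_approachable dist_commute)
  have "x \<notin> support G" using x r(2) e(2) inside_no_overlap[of "path_image g"] by blast
  let ?F = "connected_component_set (- support G) x"
  have F: "?F \<in> faces G" using \<open>x \<notin> support G\<close> by (auto simp: faces_def intro: componentsI)
  have xF: "x \<in> ?F" using \<open>x \<notin> support G\<close> by simp
  have Fsub: "?F \<inter> support G = {}" using connected_component_subset[of "- support G" x] by auto
  have "?F \<subseteq> ?R"
  proof (rule ccontr)
    assume "\<not> ?F \<subseteq> ?R"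
    then have "?F - ?R \<noteq> {}" by blast
    moreover have "?F \<inter> ?R \<noteq> {}" using x(1) xF by blast
    ultimately have "?F \<inter> frontier ?R \<noteq> {}"
      by (intro connected_Int_frontier connected_connected_component)
    moreover have "frontier ?R = path_image g" using J by simp
    ultimately show False using Fsub D(3) by blast
  qed
  moreover have "bounded ?R" using J by simp
  then have "bounded ?F" by (rule bounded_subset) fact
  moreover have "ball q r \<inter> frontier ?F \<noteq> {}"
  proof (rule connected_Int_frontier)
    have "q \<in> support G" using q edge_image_props(4)[OF e(1)] by auto
    then show "ball q r - ?F \<noteq> {}" using r(1) Fsub by (metis Diff_iff IntI centre_in_ball empty_iff)
  qed (use x xF in auto)
  moreover have "frontier ?F \<subseteq> support G"
    using F compact_support[OF plane]
    by (intro frontier_of_components_closed_complement) (auto simp: faces_def compact_imp_closed)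
  ultimately show ?thesis using that[OF F] r(2) by blast
qed

context
  fixes p assumes cyc: "is_cycle G p"
begin

text \<open>
  The drawing of the cycle from \<open>p ! i\<close> to \<open>p ! j\<close> in the direction of increasing indices.
\<close>

definition boundary_part :: "nat \<Rightarrow> nat \<Rightarrow> complex set" where
  "boundary_part i j = (\<Union>t\<in>{i..<j}. edge_image G {p ! t, p ! Suc t})"

lemma nth_eq: "i < length p \<Longrightarrow> j < length p \<Longrightarrow> p ! i = p ! j \<longleftrightarrow> i = j"
  using cyc by (simp add: is_cycle_def nth_eq_iff_index_eq)

lemma n_ge_3: "3 \<le> length p" using cyc by (simp add: is_cycle_def)

lemma p_nonempty: "p \<noteq> []" using n_ge_3 by auto

lemma Suc_last: "Suc (length p - Suc 0) = length p" using n_ge_3 by simp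

lemma cycle_edge: "Suc t < length p \<Longrightarrow> {p ! t, p ! Suc t} \<in> edges G"
  using cyc unfolding is_cycle_def cycle_edges_def
  by (metis (mono_tags, lifting) Suc_lessD mem_Collect_eq mod_less subsetD)

lemma closing_edge: "{p ! 0, p ! (length p - 1)} \<in> edges G"
proof -
  have "{p ! (length p - 1), p ! (Suc (length p - 1) mod length p)} \<in> cycle_edges p"
    unfolding cycle_edges_def using n_ge_3 by (auto intro!: exI[of _ "length p - 1"])
  then show ?thesis using cyc by (auto simp: is_cycle_def insert_commute Suc_last)
qed

lemma cycle_edges_image:
  "(\<Union>e\<in>cycle_edges p. edge_image G e) = boundary_part 0 (length p - 1) \<union> edge_image G {p ! 0, p ! (length p - 1)}"
proof -
  note cycle_edges_eq_image
  also have "{..<length p} = insert (length p - 1) {0..<length p - 1}" using n_ge_3 by auto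
  also have "(\<lambda>t. {p ! t, p ! (Suc t mod length p)}) ` \<dots> =
      insert {p ! 0, p ! (length p - 1)} ((\<lambda>t. {p ! t, p ! Suc t}) ` {0..<length p - 1})"
    by (simp add: insert_commute Suc_last)
  finally show ?thesis by (auto simp: boundary_part_def)
qed

lemma vertex: "i < length p \<Longrightarrow> p ! i \<in> verts G"
  using cyc by (auto simp: is_cycle_def)

lemma boundary_part_verts:
  assumes "v \<in> verts G" "v \<in> boundary_part i j" "j < length p"
  shows "\<exists>m. i \<le> m \<and> m \<le> j \<and> v = p ! m"
proof -
  obtain t where t: "i \<le> t" "t < j" "v \<in> edge_image G {p ! t, p ! Suc t}"
    using assms(2) by (auto simp: boundary_part_def)
  then have "v \<in> {p ! t, p ! Suc t}"
    using edge_image_props(5)[OF cycle_edge, of t] assms by auto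
  then show ?thesis using t by (metis Suc_leI insertE le_Suc_eq less_imp_le_nat singletonD)
qed

lemma vertex_in_boundary_part:
  assumes "m < length p" "j < length p" "p ! m \<in> boundary_part i j"
  shows "i \<le> m \<and> m \<le> j"
  using boundary_part_verts[OF vertex assms(3,2)] assms(1,2) nth_eq by (metis le_less_trans)

lemma chord_index:
  assumes "i < j" "j < length p" "a < b" "b < length p" "{p ! i, p ! j} = {p ! a, p ! b}"
  shows "i = a" "j = b"
  using assms nth_eq by (auto simp: doubleton_eq_iff)

lemma chord_meets_boundary:
  assumes e: "{p ! i, p ! j} \<in> edges G" "i < j" "j < length p" "b < length p"
    and nb: "\<And>t. \<lbrakk>a \<le> t; t < b\<rbrakk> \<Longrightarrow> \<not> (i = t \<and> j = Suc t)"
  shows "edge_image G {p ! i, p ! j} \<inter> boundary_part a b \<subseteq> {p ! i, p ! j}"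
proof
  fix x assume x: "x \<in> edge_image G {p ! i, p ! j} \<inter> boundary_part a b"
  then obtain t where t: "a \<le> t" "t < b" "x \<in> edge_image G {p ! t, p ! Suc t}"
    by (auto simp: boundary_part_def)
  have "{p ! i, p ! j} \<noteq> {p ! t, p ! Suc t}"
    using chord_index[OF e(2,3), of t "Suc t"] nb[OF t(1,2)] t e(4) by auto
  moreover have "Suc t < length p" using t(2) e(4) by simp
  ultimately show "x \<in> {p ! i, p ! j}"
    using edge_images_meet[OF e(1) cycle_edge, of t] t(3) x by blast
qed

lemma boundary_parts_meet:
  assumes "b < length p" "d < length p" "b \<le> c \<or> d \<le> a" "x \<in> boundary_part a b" "x \<in> boundary_part c d"
  shows "\<exists>m. a \<le> m \<and> m \<le> b \<and> c \<le> m \<and> m \<le> d \<and> x = p ! m"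
proof -
  obtain t where t: "c \<le> t" "t < d" "x \<in> edge_image G {p ! t, p ! Suc t}"
    using assms(5) by (auto simp: boundary_part_def)
  have "edge_image G {p ! t, p ! Suc t} \<inter> boundary_part a b \<subseteq> {p ! t, p ! Suc t}"
    by (rule chord_meets_boundary) (use t assms cycle_edge in auto)
  then have "x \<in> {p ! t, p ! Suc t}" using t assms(4) by auto
  then obtain m where m: "x = p ! m" "c \<le> m" "m \<le> d" using t by auto
  then have "a \<le> m \<and> m \<le> b" using vertex_in_boundary_part[of m b a] assms(1,2,4) by simp
  then show ?thesis using m by blast
qed

lemma boundary_part_Suc:
  "i \<le> j \<Longrightarrow> boundary_part i (Suc j) = boundary_part i j \<union> edge_image G {p ! j, p ! Suc j}"
  by (auto simp: boundary_part_def less_Suc_eq)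

lemma boundary_part_support: "j < length p \<Longrightarrow> boundary_part i j \<subseteq> support G"
proof -
  assume j: "j < length p"
  have "edge_image G {p ! t, p ! Suc t} \<subseteq> support G" if "t \<in> {i..<j}" for t
    using edge_image_props(4)[OF cycle_edge, of t] that j by auto
  then show ?thesis unfolding boundary_part_def by (rule UN_least)
qed

lemma boundary_arc:
  assumes "i < j" "j < length p"
  shows "\<exists>g. arc g \<and> pathstart g = p ! i \<and> pathfinish g = p ! j \<and> path_image g = boundary_part i j"
  using assms
proof (induction j)
  case (Suc j)
  obtain h where h: "arc h" "pathstart h = p ! j" "pathfinish h = p ! Suc j"
    "path_image h = edge_image G {p ! j, p ! Suc j}"
    using oriented_curve[OF cycle_edge] Suc.prems by metis
  show ?case
  proof (cases "i = j")
    case True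
    then show ?thesis using h by (auto simp: boundary_part_def)
  next
    case False
    then obtain g where g: "arc g" "pathstart g = p ! i" "pathfinish g = p ! j" "path_image g = boundary_part i j"
      using Suc by auto
    have "path_image g \<inter> path_image h \<subseteq> {pathstart h}"
    proof
      fix x assume x: "x \<in> path_image g \<inter> path_image h"
      have "path_image h = boundary_part j (Suc j)" using h by (auto simp: boundary_part_def)
      then obtain m where "m \<le> j" "j \<le> m" "x = p ! m"
        using boundary_parts_meet[of j "Suc j" j i x] x g(4) Suc.prems by auto
      then show "x \<in> {pathstart h}" using h by auto
    qed
    then have "arc (g +++ h)" using g h by (intro arc_join) simp_all
    moreover have "path_image (g +++ h) = boundary_part i (Suc j)"
      using g(3,4) h(2,4) Suc.prems boundary_part_Suc[of i j] by (simp add: path_image_join)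
    ultimately show ?thesis using g(2) h(3) by (intro exI[of _ "g +++ h"]) simp
  qed
qed simp

text \<open>
  The rest of the cycle, which passes through the edge between the last and the first vertex.
\<close>

definition co_boundary_part :: "nat \<Rightarrow> nat \<Rightarrow> complex set" where
  "co_boundary_part i j = boundary_part j (length p - 1) \<union> edge_image G {p ! 0, p ! (length p - 1)} \<union> boundary_part 0 i"

lemma closing_meets_boundary:
  assumes "b < length p" "a > 0 \<or> b < length p - 1"
  shows "edge_image G {p ! 0, p ! (length p - 1)} \<inter> boundary_part a b \<subseteq> {p ! 0, p ! (length p - 1)}"
  by (rule chord_meets_boundary) (use closing_edge n_ge_3 assms in auto)

lemma co_boundary_arc:
  assumes "i < j" "j < length p - 1"
  shows "\<exists>g. arc g \<and> pathstart g = p ! j \<and> pathfinish g = p ! i \<and> path_image g = co_boundary_part i j"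
  using assms
proof (induction i)
  case 0
  have "{p ! (length p - 1), p ! 0} \<in> edges G" using closing_edge by (simp add: insert_commute)
  then obtain h where h: "arc h" "pathstart h = p ! (length p - 1)" "pathfinish h = p ! 0"
    "path_image h = edge_image G {p ! 0, p ! (length p - 1)}"
    by (rule oriented_curve) (simp add: insert_commute)
  obtain g where g: "arc g" "pathstart g = p ! j" "pathfinish g = p ! (length p - 1)" "path_image g = boundary_part j (length p - 1)"
    using boundary_arc[of j "length p - 1"] 0 p_nonempty by auto
  have "path_image g \<inter> path_image h \<subseteq> {pathstart h}"
  proof
    fix x assume x: "x \<in> path_image g \<inter> path_image h"
    have "edge_image G {p ! 0, p ! (length p - 1)} \<inter> boundary_part j (length p - 1) \<subseteq> {p ! 0, p ! (length p - 1)}"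
      by (rule closing_meets_boundary) (use 0 p_nonempty in auto)
    then have "x \<in> {p ! 0, p ! (length p - 1)}" using x g(4) h(4) by blast
    moreover have "x \<noteq> p ! 0"
      using vertex_in_boundary_part[of 0 "length p - 1" j] 0 g(4) x p_nonempty by auto
    ultimately show "x \<in> {pathstart h}" using h by auto
  qed
  then have "arc (g +++ h)" using g h by (intro arc_join) simp_all
  moreover have "path_image (g +++ h) = co_boundary_part 0 j"
    using g(3,4) h(2,4) by (simp add: path_image_join co_boundary_part_def boundary_part_def[of 0 0])
  ultimately show ?case using g(2) h(3) by (intro exI[of _ "g +++ h"]) simp
next
  case (Suc i)
  have "Suc i < length p" using Suc.prems by simp
  from oriented_curve[OF cycle_edge[OF this]] obtain h where h: "arc h" "pathstart h = p ! i"
    "pathfinish h = p ! Suc i" "path_image h = edge_image G {p ! i, p ! Suc i}" .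
  have hb: "path_image h = boundary_part i (Suc i)" using h by (auto simp: boundary_part_def)
  obtain g where g: "arc g" "pathstart g = p ! j" "pathfinish g = p ! i" "path_image g = co_boundary_part i j"
    using Suc by auto
  have "path_image g \<inter> path_image h \<subseteq> {pathstart h}"
  proof
    fix x assume x: "x \<in> path_image g \<inter> path_image h"
    consider "x \<in> boundary_part j (length p - 1)" | "x \<in> edge_image G {p ! 0, p ! (length p - 1)}" | "x \<in> boundary_part 0 i"
      using x g(4) by (auto simp: co_boundary_part_def)
    then show "x \<in> {pathstart h}"
    proof cases
      case 1
      then show ?thesis using boundary_parts_meet[of "length p - 1" "Suc i" i j x] x hb Suc.prems p_nonempty \<open>Suc i < length p\<close> by auto
    next
      case 2
      then have x2: "x \<in> {p ! 0, p ! (length p - 1)}"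
        using closing_meets_boundary[of "Suc i" i] Suc.prems x hb \<open>Suc i < length p\<close> by auto
      moreover have "x \<noteq> p ! (length p - 1)"
        using vertex_in_boundary_part[of "length p - 1" "Suc i" i] Suc.prems x hb \<open>Suc i < length p\<close> p_nonempty by auto
      moreover have "x = p ! 0 \<Longrightarrow> i = 0"
        using vertex_in_boundary_part[of 0 "Suc i" i] Suc.prems x hb \<open>Suc i < length p\<close> p_nonempty by auto
      ultimately show ?thesis using h by auto
    next
      case 3
      then show ?thesis using boundary_parts_meet[of i "Suc i" i 0 x] x hb Suc.prems h \<open>Suc i < length p\<close> by auto
    qed
  qed
  then have "arc (g +++ h)" using g h by (intro arc_join) simp_all
  moreover have "path_image (g +++ h) = co_boundary_part (Suc i) j"
    using g(3,4) h(2,4) boundary_part_Suc[of 0 i]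
    by (simp add: path_image_join co_boundary_part_def Un_assoc)
  ultimately show ?case using g(2) h(3) by (intro exI[of _ "g +++ h"]) simp
qed

lemma boundary_split:
  assumes "i < j" "j < length p - 1"
  shows "boundary_part i j \<union> co_boundary_part i j = (\<Union>e\<in>cycle_edges p. edge_image G e)"
proof -
  have "{0..<length p - 1} = {0..<i} \<union> {i..<j} \<union> {j..<length p - 1}" using assms by auto
  then have "boundary_part 0 (length p - 1) = boundary_part 0 i \<union> boundary_part i j \<union> boundary_part j (length p - 1)"
    by (auto simp: boundary_part_def)
  then show ?thesis unfolding cycle_edges_image co_boundary_part_def by blast
qed

lemma vertex_in_co_boundary_part:
  assumes "m < length p" "i < j" "j < length p - 1" "p ! m \<in> co_boundary_part i j"
  shows "m \<le> i \<or> j \<le> m"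
proof -
  consider "p ! m \<in> boundary_part j (length p - 1)" | "p ! m \<in> edge_image G {p ! 0, p ! (length p - 1)}" | "p ! m \<in> boundary_part 0 i"
    using assms(4) by (auto simp: co_boundary_part_def)
  then show ?thesis
  proof cases
    case 2
    then have "p ! m \<in> {p ! 0, p ! (length p - 1)}"
      using edge_image_props(5)[OF closing_edge] vertex[OF assms(1)] by auto
    then have "m = 0 \<or> m = length p - 1"
      using nth_eq[OF assms(1), of 0] nth_eq[OF assms(1), of "length p - 1"] n_ge_3 p_nonempty by auto
    then show ?thesis using assms by auto
  next
    case 1
    then show ?thesis using vertex_in_boundary_part[of m "length p - 1" j] assms(1) p_nonempty by auto
  next
    case 3
    then show ?thesis using vertex_in_boundary_part[of m i 0] assms by auto
  qed
qed

lemma boundary_parts_Int: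
  assumes "i < j" "j < length p - 1"
  shows "boundary_part i j \<inter> co_boundary_part i j \<subseteq> {p ! i, p ! j}"
proof
  fix x assume x: "x \<in> boundary_part i j \<inter> co_boundary_part i j"
  have "x \<in> verts G"
  proof -
    consider "x \<in> boundary_part j (length p - 1)" | "x \<in> edge_image G {p ! 0, p ! (length p - 1)}" | "x \<in> boundary_part 0 i"
      using x by (auto simp: co_boundary_part_def)
    then show ?thesis
    proof cases
      case 1
      then show ?thesis using boundary_parts_meet[of j "length p - 1" j i x] x assms vertex p_nonempty by auto
    next
      case 2
      have "edge_image G {p ! 0, p ! (length p - 1)} \<inter> boundary_part i j \<subseteq> {p ! 0, p ! (length p - 1)}"
        by (rule closing_meets_boundary) (use assms in auto)
      then have "x \<in> {p ! 0, p ! (length p - 1)}" using x 2 by blast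
      then show ?thesis using vertex p_nonempty by auto
    next
      case 3
      have "j < length p" "i < length p" using assms by auto
      then obtain m where "m \<le> j" "x = p ! m"
        using boundary_parts_meet[of j i 0 i x] x 3 by auto
      then show ?thesis using vertex[of m] assms by auto
    qed
  qed
  then obtain m where m: "i \<le> m" "m \<le> j" "x = p ! m"
    using boundary_part_verts[of x i j] x assms(2) less_le_trans[OF assms(2) diff_le_self] by auto
  then have "m \<le> i \<or> j \<le> m" using vertex_in_co_boundary_part[of m i j] x assms by auto
  then show "x \<in> {p ! i, p ! j}" using m by auto
qed

lemma chord_meets_co_boundary:
  assumes e: "{p ! i, p ! j} \<in> edges G" "Suc i < j" "j < length p" "0 < i \<or> j < length p - 1"
    and "a < b" "b < length p - 1"
  shows "edge_image G {p ! i, p ! j} \<inter> co_boundary_part a b \<subseteq> {p ! i, p ! j}"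
proof -
  have "edge_image G {p ! i, p ! j} \<inter> boundary_part c d \<subseteq> {p ! i, p ! j}" if "d < length p" for c d
    by (rule chord_meets_boundary) (use assms that in auto)
  from this[of a 0] this[of "length p - 1" b]
  have "edge_image G {p ! i, p ! j} \<inter> boundary_part 0 a \<subseteq> {p ! i, p ! j}"
    "edge_image G {p ! i, p ! j} \<inter> boundary_part b (length p - 1) \<subseteq> {p ! i, p ! j}"
    using assms(5,6) p_nonempty by simp_all
  moreover have "edge_image G {p ! i, p ! j} \<inter> edge_image G {p ! 0, p ! (length p - 1)} \<subseteq> {p ! i, p ! j}"
  proof -
    have "{p ! i, p ! j} \<noteq> {p ! 0, p ! (length p - 1)}"
    proof
      assume eq: "{p ! i, p ! j} = {p ! 0, p ! (length p - 1)}"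
      have "i < j" "0 < length p - 1" "length p - 1 < length p" using e(2) n_ge_3 by auto
      from chord_index[OF this(1) e(3) this(2,3) eq] show False using e(4) by simp
    qed
    from edge_images_meet[OF e(1) closing_edge this] show ?thesis by blast
  qed
  ultimately show ?thesis
    unfolding co_boundary_part_def by blast
qed

end

end

locale mop_drawing =
  fixes G p
  assumes plane: "plane G"
    and inner_faces: "\<lbrakk>F \<in> faces G; F \<noteq> exterior_face G\<rbrakk> \<Longrightarrow> \<exists>q. length q = 3 \<and> bounded_by_cycle G F q"
    and outer: "bounded_by_cycle G (exterior_face G) p"
    and all_outer: "verts G \<subseteq> frontier (exterior_face G)"
begin

lemma cyc: "is_cycle G p" using outer by (simp add: bounded_by_cycle_def)

abbreviation n where "n \<equiv> length p"

abbreviation part where "part \<equiv> boundary_part G p"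

abbreviation copart where "copart \<equiv> co_boundary_part G p"

lemmas props = edge_image_props[OF plane]

lemma exterior:
  "connected (exterior_face G)" "\<not> bounded (exterior_face G)" "exterior_face G \<inter> support G = {}"
  "exterior_face G \<noteq> {}"
  using exterior_face_unique(1,2)[OF plane]
  by (auto simp: faces_def dest: in_components_connected in_components_subset in_components_nonempty)

lemma verts_eq: "verts G = set p"
proof
  show "verts G \<subseteq> set p"
  proof
    fix v assume v: "v \<in> verts G"
    then obtain e where e: "e \<in> cycle_edges p" "v \<in> edge_image G e"
      using all_outer outer by (auto simp: bounded_by_cycle_def)
    then have "v \<in> e" using props(5)[of e] cyc v by (auto simp: is_cycle_def)
    then obtain i where i: "i < n" "v = p ! i \<or> v = p ! (Suc i mod n)"
      using e(1) by (auto simp: cycle_edges_def)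
    have "0 < n" using i(1) by linarith
    then have "Suc i mod n < n" by simp
    then show "v \<in> set p" using i by auto
  qed
qed (use cyc in \<open>auto simp: is_cycle_def\<close>)

text \<open>
  The exterior face is connected, unbounded and disjoint from the curve, hence outside it; so no point
  of the frontier of the exterior face is inside.
\<close>

lemma vertex_not_inside:
  assumes D: "simple_path g" "pathfinish g = pathstart g" "path_image g \<subseteq> support G" and "v \<in> verts G"
  shows "v \<notin> inside (path_image g)"
proof -
  note J = Jordan_inside_outside[OF D(1,2)]
  have "exterior_face G \<subseteq> outside (path_image g)"
    using exterior D(3) by (intro unbounded_connected_subset_outside) auto
  then have "closure (exterior_face G) \<subseteq> closure (outside (path_image g))" by (rule closure_mono)
  moreover have "inside (path_image g) \<inter> closure (outside (path_image g)) = {}"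
    using J by (simp add: open_Int_closure_eq_empty)
  moreover have "v \<in> closure (exterior_face G)"
    using all_outer assms(4) by (auto simp: frontier_def)
  ultimately show ?thesis by blast
qed

text \<open>
  Close the part of the exterior cycle from \<open>p ! i\<close> to \<open>p ! j\<close> by the edge between these vertices. A
  face inside this Jordan curve that touches the edge is a triangle containing the edge. Its third
  corner is in the closure of the inside but, being a vertex, not inside; so it is on the curve.
\<close>

lemma triangle_apex:
  assumes e: "{p ! i, p ! j} \<in> edges G" "Suc i < j" "j < n"
  obtains t where "i < t" "t < j" "{p ! i, p ! t} \<in> edges G" "{p ! t, p ! j} \<in> edges G"
proof -
  let ?e = "{p ! i, p ! j}"
  obtain g where g: "arc g" "pathstart g = p ! i" "pathfinish g = p ! j" "path_image g = part i j"
    using boundary_arc[OF plane cyc, of i j] e by auto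
  have "{p ! j, p ! i} \<in> edges G" using e(1) by (simp add: insert_commute)
  then obtain h where h: "arc h" "pathstart h = p ! j" "pathfinish h = p ! i" "path_image h = edge_image G ?e"
    by (rule oriented_curve[OF plane]) (simp add: insert_commute)
  have gh: "path_image g \<inter> path_image h \<subseteq> {p ! i, p ! j}"
    using chord_meets_boundary[OF plane cyc e(1), of j i] e g h by auto
  define D where "D = path_image (g +++ h)"
  have D: "D = part i j \<union> edge_image G ?e" unfolding D_def using g h by (simp add: path_image_join)
  have sp: "simple_path (g +++ h)" "pathfinish (g +++ h) = pathstart (g +++ h)"
    using g h gh by (auto intro!: simple_path_join_loop)
  have Dsup: "D \<subseteq> support G"
    using D boundary_part_support[OF plane cyc] props(4) e by auto
  obtain F y where F: "F \<in> faces G" "bounded F" "F \<subseteq> inside D" "y \<in> frontier F" "y \<in> edge_image G ?e - ?e"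
    using face_inside_at_edge[OF plane sp, of ?e] e(1) D Dsup unfolding D_def[symmetric] by auto
  have "F \<noteq> exterior_face G" using F(2) exterior by auto
  then obtain q where q: "length q = 3" "is_cycle G q" "frontier F = (\<Union>f\<in>cycle_edges q. edge_image G f)"
    using inner_faces[OF F(1)] by (auto simp: bounded_by_cycle_def)
  obtain a b c where abc: "q = [a, b, c]"
    using q(1) by (metis (no_types, opaque_lifting) length_0_conv length_Suc_conv numeral_3_eq_3)
  have "{..<3} = {0, 1, 2::nat}" by auto
  have "cycle_edges q = (\<lambda>i. {q ! i, q ! (Suc i mod length q)}) ` {..<3}"
    unfolding cycle_edges_eq_image q(1) by (rule refl)
  then have ce: "cycle_edges q = {{a, b}, {b, c}, {c, a}}"
    unfolding \<open>{..<3} = _\<close> abc by simp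
  have dist: "a \<noteq> b" "b \<noteq> c" "c \<noteq> a" and E: "{a, b} \<in> edges G" "{b, c} \<in> edges G" "{c, a} \<in> edges G"
    using q(2) ce unfolding is_cycle_def abc by auto
  obtain f where f: "f \<in> cycle_edges q" "y \<in> edge_image G f" using F(4) q(3) by auto
  have "f \<in> edges G" using f(1) E ce by auto
  then have "f = ?e" using edge_images_meet[OF plane e(1), of f] f(2) F(5) by blast
  then consider "?e = {a, b}" | "?e = {b, c}" | "?e = {c, a}" using f(1) unfolding ce by auto
  then obtain w where w: "{p ! i, w} \<in> edges G" "{w, p ! j} \<in> edges G" "w \<noteq> p ! i" "w \<noteq> p ! j" "w \<in> {a, b, c}"
  proof cases
    case 1
    then show ?thesis using that[of c] E dist by (auto simp: doubleton_eq_iff insert_commute)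
  next
    case 2
    then show ?thesis using that[of a] E dist by (auto simp: doubleton_eq_iff insert_commute)
  next
    case 3
    then show ?thesis using that[of b] E dist by (auto simp: doubleton_eq_iff insert_commute)
  qed
  have "w \<in> frontier F" using w(5) props(3)[OF E(1)] props(3)[OF E(2)] unfolding q(3) ce by auto
  then have "w \<in> closure (inside D)" using F(3) closure_mono by (auto simp: frontier_def)
  moreover have wv: "w \<in> verts G" using edge_ends[OF plane w(1)] by auto
  moreover have "closure (inside D) = inside D \<union> D"
    using Jordan_inside_outside[OF sp] unfolding D_def by (simp add: closure_Un_frontier)
  moreover have "w \<notin> inside D"
    using vertex_not_inside[OF sp _ wv] Dsup unfolding D_def by blast
  ultimately have "w \<in> D" by blast
  then have "w \<in> part i j" using D w props(5)[OF e(1)] wv by auto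
  then obtain t where "i \<le> t" "t \<le> j" "w = p ! t" using boundary_part_verts[OF plane cyc wv] e by blast
  moreover from this have "i \<noteq> t" "t \<noteq> j" using w(3,4) by auto
  ultimately show ?thesis using that[of t] w(1,2) by simp
qed

text \<open>
  The exterior face lies outside its boundary cycle, and the outside is connected and contains no
  point of the frontier of that face.
\<close>

lemma exterior_eq_outside:
  assumes "simple_path g" "pathfinish g = pathstart g"
    and "path_image g = (\<Union>e\<in>cycle_edges p. edge_image G e)"
  shows "exterior_face G = outside (path_image g)"
proof
  note J = Jordan_inside_outside[OF assms(1,2)]
  have fr: "frontier (exterior_face G) = path_image g"
    using outer assms(3) by (simp add: bounded_by_cycle_def)
  have "path_image g \<subseteq> support G"
    using assms(3) props(4) cyc by (auto simp: is_cycle_def)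
  then show sub: "exterior_face G \<subseteq> outside (path_image g)"
    using exterior by (intro unbounded_connected_subset_outside) auto
  show "outside (path_image g) \<subseteq> exterior_face G"
  proof (rule ccontr)
    assume "\<not> outside (path_image g) \<subseteq> exterior_face G"
    then have "outside (path_image g) \<inter> frontier (exterior_face G) \<noteq> {}"
      using J exterior(4) sub by (intro connected_Int_frontier) auto
    then show False using fr by simp
  qed
qed

text \<open>
  The chord from \<open>p ! i\<close> to \<open>p ! j\<close> runs inside the exterior cycle and cuts the inside into two parts.
  A second chord runs inside the cycle too and does not meet the first, so it stays in one part; but if
  its ends are on different sides of the first chord, neither part has both ends in its closure.
\<close>

lemma chords_noncrossing:
  assumes e: "{p ! i, p ! j} \<in> edges G" "j < n" and f: "{p ! a, p ! b} \<in> edges G" "b < n"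
    and "i < a" "a < j"
  shows "b \<le> j"
proof (rule ccontr)
  assume "\<not> b \<le> j"
  then have o: "i < a" "a < j" "j < b" "b < n" "j < n - 1" using assms by auto
  let ?e = "{p ! i, p ! j}" and ?f = "{p ! a, p ! b}"
  obtain c1 where c1: "arc c1" "pathstart c1 = p ! i" "pathfinish c1 = p ! j" "path_image c1 = part i j"
    using boundary_arc[OF plane cyc, of i j] o by auto
  obtain g2 where g2: "arc g2" "pathstart g2 = p ! j" "pathfinish g2 = p ! i" "path_image g2 = copart i j"
    using co_boundary_arc[OF plane cyc, of i j] o by auto
  define c2 where "c2 = reversepath g2"
  have c2: "arc c2" "pathstart c2 = p ! i" "pathfinish c2 = p ! j" "path_image c2 = copart i j"
    using g2 by (auto simp: c2_def arc_reversepath)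
  obtain c where c: "arc c" "pathstart c = p ! i" "pathfinish c = p ! j" "path_image c = edge_image G ?e"
    by (rule oriented_curve[OF plane e(1)])
  obtain d where d: "arc d" "pathstart d = p ! a" "pathfinish d = p ! b" "path_image d = edge_image G ?f"
    by (rule oriented_curve[OF plane f(1)])
  have ends: "p ! i \<in> path_image c1" "p ! j \<in> path_image c1" "p ! i \<in> path_image c2" "p ! j \<in> path_image c2"
    "p ! i \<in> path_image c" "p ! j \<in> path_image c"
    using c1 c2 c by (metis pathstart_in_path_image pathfinish_in_path_image)+
  have i12: "path_image c1 \<inter> path_image c2 = {p ! i, p ! j}"
    using boundary_parts_Int[OF plane cyc, of i j] o ends c1(4) c2(4) by auto
  have i1: "path_image c1 \<inter> path_image c = {p ! i, p ! j}"
    using chord_meets_boundary[OF plane cyc e(1), of j i] o ends c1(4) c(4) by auto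
  have i2: "path_image c2 \<inter> path_image c = {p ! i, p ! j}"
    using chord_meets_co_boundary[OF plane cyc e(1), of i j] o ends c2(4) c(4) by auto
  have sp: "simple_path (c1 +++ g2)" "pathfinish (c1 +++ g2) = pathstart (c1 +++ g2)"
    using c1 g2 i12 c2(4) by (auto intro!: simple_path_join_loop)
  have C: "path_image (c1 +++ g2) = path_image c1 \<union> path_image c2"
    using c1 g2 c2 by (simp add: path_image_join)
  have C': "path_image c1 \<union> path_image c2 = (\<Union>e\<in>cycle_edges p. edge_image G e)"
    using boundary_split[OF plane cyc, of i j] o c1(4) c2(4) by auto
  note J = Jordan_inside_outside[OF sp, unfolded C]
  have ext_eq: "exterior_face G = outside (path_image c1 \<union> path_image c2)"
    using exterior_eq_outside[OF sp] C C' by simp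
  have chord_inside: "edge_image G h - h \<subseteq> inside (path_image c1 \<union> path_image c2)"
    if h: "h \<in> edges G" "edge_image G h \<inter> (path_image c1 \<union> path_image c2) \<subseteq> h" for h
  proof -
    have "inside (path_image c1 \<union> path_image c2) \<union> outside (path_image c1 \<union> path_image c2)
        = - (path_image c1 \<union> path_image c2)"
      using J by simp
    moreover have "edge_image G h \<inter> outside (path_image c1 \<union> path_image c2) = {}"
      using props(4)[OF h(1)] exterior(3) unfolding ext_eq by blast
    ultimately show ?thesis using h(2) by blast
  qed
  have e_in: "path_image c - ?e \<subseteq> inside (path_image c1 \<union> path_image c2)"
    unfolding c(4) by (rule chord_inside) (use e i1 i2 c(4) in blast)+
  have f1: "edge_image G ?f \<inter> path_image c1 \<subseteq> ?f"
    using chord_meets_boundary[OF plane cyc f(1), of j i] o c1(4) by auto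
  have f2: "edge_image G ?f \<inter> path_image c2 \<subseteq> ?f"
    using chord_meets_co_boundary[OF plane cyc f(1), of i j] o c2(4) by auto
  have f_in: "path_image d - ?f \<subseteq> inside (path_image c1 \<union> path_image c2)"
    unfolding d(4) by (rule chord_inside) (use f(1) f1 f2 in blast)+
  have ne: "p ! a \<noteq> p ! i" "p ! a \<noteq> p ! j" "p ! b \<noteq> p ! i" "p ! b \<noteq> p ! j" "p ! i \<noteq> p ! j"
    using nth_eq[OF plane cyc] o by auto
  have ab_e: "p ! a \<notin> path_image c" "p ! b \<notin> path_image c"
    using props(5)[OF e(1)] ne vertex[OF plane cyc, of a] vertex[OF plane cyc, of b] o unfolding c(4)
    by auto
  have "?e \<noteq> ?f" using ne by (auto simp: doubleton_eq_iff)
  then have fe: "path_image d \<inter> path_image c \<subseteq> ?f"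
    using edge_images_meet[OF plane f(1) e(1)] c(4) d(4) by auto
  obtain q where "q \<in> path_image c - ?e" using edge_interior_point[OF plane e(1)] c(4) by auto
  then have "path_image c \<inter> inside (path_image c1 \<union> path_image c2) \<noteq> {}" using e_in by blast
  then obtain
      split: "inside (path_image c1 \<union> path_image c) \<inter> inside (path_image c2 \<union> path_image c) = {}"
        "inside (path_image c1 \<union> path_image c) \<union> inside (path_image c2 \<union> path_image c) \<union>
           (path_image c - {p ! i, p ! j}) = inside (path_image c1 \<union> path_image c2)"
    using split_inside_simple_closed_curve[OF arc_imp_simple_path[OF c1(1)] c1(2,3)
        arc_imp_simple_path[OF c2(1)] c2(2,3) arc_imp_simple_path[OF c(1)] c(2,3) ne(5) i12 i1 i2]
    by blast
  let ?A = "inside (path_image c1 \<union> path_image c)" and ?B = "inside (path_image c2 \<union> path_image c)"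
  have loop: "simple_path (x +++ reversepath c)" "pathfinish (x +++ reversepath c) = pathstart (x +++ reversepath c)"
    "path_image (x +++ reversepath c) = path_image x \<union> path_image c"
    if "x \<in> {c1, c2}" for x
    using that c1 c2 c i1 i2 by (auto simp: path_image_join arc_reversepath intro!: simple_path_join_loop)
  have Jx: "open (inside (path_image x \<union> path_image c))"
      "closure (inside (path_image x \<union> path_image c)) = inside (path_image x \<union> path_image c) \<union> (path_image x \<union> path_image c)"
    if "x \<in> {c1, c2}" for x
    using Jordan_inside_outside[OF loop(1,2)[OF that], unfolded loop(3)[OF that]] by (auto simp: closure_Un_frontier)
  have conn: "connected (path_image d - ?f)"
    using connected_simple_path_endless[of d] d by (simp add: arc_imp_simple_path)
  have "path_image d - ?f \<subseteq> ?A \<union> ?B" using f_in split(2) fe by blast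
  then have "path_image d - ?f \<subseteq> ?A \<or> path_image d - ?f \<subseteq> ?B"
    using connectedD[OF conn Jx(1)[of c1] Jx(1)[of c2]] split(1) by blast
  then have "closure (path_image d - ?f) \<subseteq> closure ?A \<or> closure (path_image d - ?f) \<subseteq> closure ?B"
    using closure_mono by blast
  moreover have "path_image d \<subseteq> closure (path_image d - ?f)"
    using arc_image_subset_closure_interior[OF d(1)] d(2,3) by simp
  ultimately have d_cl: "path_image d \<subseteq> closure ?A \<or> path_image d \<subseteq> closure ?B" by blast
  have ab_d: "p ! a \<in> path_image d" "p ! b \<in> path_image d"
    using d by (metis pathstart_in_path_image pathfinish_in_path_image)+
  have ab_c: "p ! b \<notin> path_image c1" "p ! a \<notin> path_image c2"
    using vertex_in_boundary_part[OF plane cyc, of b j i] vertex_in_co_boundary_part[OF plane cyc, of a i j] o c1(4) c2(4)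
    by auto
  have "p ! m \<notin> inside (path_image c1 \<union> path_image c2)" if "m < n" for m
  proof -
    have "(\<Union>e\<in>cycle_edges p. edge_image G e) \<subseteq> support G"
      using props(4) cyc by (intro UN_least) (auto simp: is_cycle_def)
    then show ?thesis
      using vertex_not_inside[OF sp, of "p ! m"] vertex[OF plane cyc that] unfolding C C' by blast
  qed
  moreover have "a < n" "b < n" using o by linarith+
  ultimately have "p ! a \<notin> ?A \<union> ?B" "p ! b \<notin> ?A \<union> ?B" using split(2) by blast+
  moreover have "closure ?A = ?A \<union> (path_image c1 \<union> path_image c)"
    "closure ?B = ?B \<union> (path_image c2 \<union> path_image c)"
    using Jx(2) by blast+
  ultimately show False using ab_e ab_c ab_d d_cl by blast
qed

definition chords :: "(nat \<times> nat) set" where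
  "chords = {(i, j). i < j \<and> j < n \<and> {p ! i, p ! j} \<in> edges G}"

lemma triangulated_polygon_chords: "triangulated_polygon {..<n} chords"
proof (unfold_locales, goal_cases)
  case (2 a b) then show ?case by (auto simp: chords_def)
next
  case 3
  have "Min {..<n} = 0" "Max {..<n} = n - 1"
    using n_ge_3[OF plane cyc] by (auto intro!: Min_eqI Max_eqI)
  then show ?case using closing_edge[OF plane cyc] n_ge_3[OF plane cyc] by (auto simp: chords_def)
next
  case (4 a b v)
  then obtain t where "a < t" "t < b" "{p ! a, p ! t} \<in> edges G" "{p ! t, p ! b} \<in> edges G"
    using triangle_apex[of a b] by (auto simp: chords_def)
  then show ?case using 4 by (intro exI[of _ t]) (auto simp: chords_def)
next
  case (5 a b c d)
  then show ?case using chords_noncrossing[of a b c d] unfolding chords_def by blast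
qed simp

lemma adj_chords: "i < n \<Longrightarrow> j < n \<Longrightarrow> adj chords i j \<longleftrightarrow> {p ! i, p ! j} \<in> edges G"
  using edge_ends[OF plane, of "p ! i" "p ! j"]
  by (cases i j rule: linorder_cases) (auto simp: adj_def chords_def insert_commute)

end

section \<open>Drawing a triangulated polygon on a parabola\<close>

definition parabola :: "real \<Rightarrow> complex" where
  "parabola a = Complex a (a\<^sup>2)"

text \<open>
  The ordinate over \<open>x\<close> of the line through the points of the parabola over \<open>a\<close> and \<open>b\<close>.
\<close>

definition secant :: "real \<Rightarrow> real \<Rightarrow> real \<Rightarrow> real" where
  "secant a b x = (a + b) * x - a * b"

lemma Re_parabola [simp]: "Re (parabola a) = a" and Im_parabola [simp]: "Im (parabola a) = a\<^sup>2"
  by (simp_all add: parabola_def)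

lemma parabola_eq_iff [simp]: "parabola a = parabola b \<longleftrightarrow> a = b"
  by (auto simp: parabola_def)

lemma secant_eq: "secant a b x = x\<^sup>2 + (x - a) * (b - x)"
  by (simp add: secant_def power2_eq_square algebra_simps)

lemma secant_above: "a \<le> x \<Longrightarrow> x \<le> b \<Longrightarrow> x\<^sup>2 \<le> secant a b x"
  by (simp add: secant_eq)

lemma secant_below: "a \<le> b \<Longrightarrow> x \<le> a \<or> b \<le> x \<Longrightarrow> secant a b x \<le> x\<^sup>2"
  by (auto simp: secant_eq mult_le_0_iff)

lemma secant_mono: "a \<le> c \<Longrightarrow> c \<le> x \<Longrightarrow> x \<le> d \<Longrightarrow> d \<le> b \<Longrightarrow> secant c d x \<le> secant a b x"
  unfolding secant_eq by (intro add_left_mono mult_mono) auto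

text \<open>
  This is what makes distinct edges meet in common ends only.
\<close>

lemma secant_eq_nested:
  assumes "a \<le> c" "c \<le> x" "x \<le> d" "d \<le> b" "secant c d x = secant a b x"
  shows "a = c \<and> b = d \<or> x = a \<or> x = b"
proof (rule ccontr)
  assume "\<not> ?thesis"
  then have *: "\<not> (a = c \<and> b = d)" "x > a" "x < b" using assms by auto
  have "(x - c) * (d - x) < (x - a) * (b - x)"
  proof (cases "a = c")
    case True
    then show ?thesis using * assms by simp
  next
    case False
    have "(x - c) * (d - x) \<le> (x - c) * (b - x)" using assms by (intro mult_left_mono) auto
    also have "\<dots> < (x - a) * (b - x)" using False * assms by (intro mult_strict_right_mono) auto
    finally show ?thesis .
  qed
  then show False using assms(5) by (simp add: secant_eq)
qed

lemma secant_left: "a < b \<Longrightarrow> b < c \<Longrightarrow> x \<le> b \<Longrightarrow> secant b c x \<le> secant a b x"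
  and secant_left_less: "a < b \<Longrightarrow> b < c \<Longrightarrow> x < b \<Longrightarrow> secant b c x < secant a b x"
  and secant_right: "a < b \<Longrightarrow> b < c \<Longrightarrow> b \<le> x \<Longrightarrow> secant a b x \<le> secant b c x"
  and secant_right_less: "a < b \<Longrightarrow> b < c \<Longrightarrow> b < x \<Longrightarrow> secant a b x < secant b c x"
proof -
  have d: "secant b c x - secant a b x = (c - a) * (x - b)" by (simp add: secant_def algebra_simps)
  { assume "a < b" "b < c"
    then have "c - a > 0" by simp
    with d show "x \<le> b \<Longrightarrow> secant b c x \<le> secant a b x" "x < b \<Longrightarrow> secant b c x < secant a b x"
      "b \<le> x \<Longrightarrow> secant a b x \<le> secant b c x" "b < x \<Longrightarrow> secant a b x < secant b c x"
      by (smt (verit) mult_nonneg_nonneg mult_pos_pos mult_pos_neg mult_nonneg_nonpos)+ }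
qed

lemma secant_first: "b < c \<Longrightarrow> x < a \<Longrightarrow> secant a c x < secant a b x"
  and secant_last: "a < b \<Longrightarrow> c < x \<Longrightarrow> secant a c x < secant b c x"
proof -
  have "secant a c x - secant a b x = (c - b) * (x - a)" "secant a c x - secant b c x = (a - b) * (x - c)"
    by (simp_all add: secant_def algebra_simps)
  then show "b < c \<Longrightarrow> x < a \<Longrightarrow> secant a c x < secant a b x" "a < b \<Longrightarrow> c < x \<Longrightarrow> secant a c x < secant b c x"
    by (smt (verit) mult_pos_neg mult_neg_pos)+
qed

lemma segment_parabola:
  assumes "a < b"
  shows "q \<in> closed_segment (parabola a) (parabola b) \<longleftrightarrow>
    a \<le> Re q \<and> Re q \<le> b \<and> Im q = secant a b (Re q)"
proof
  assume "q \<in> closed_segment (parabola a) (parabola b)"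
  then obtain u where u: "0 \<le> u" "u \<le> 1" "q = (1 - u) *\<^sub>R parabola a + u *\<^sub>R parabola b"
    by (auto simp: in_segment)
  then have q: "Re q = (1 - u) * a + u * b" "Im q = (1 - u) * a\<^sup>2 + u * b\<^sup>2" by auto
  have "Re q = a + u * (b - a)" "Re q = b - (1 - u) * (b - a)" using q by (simp_all add: algebra_simps)
  moreover have "0 \<le> u * (b - a)" "0 \<le> (1 - u) * (b - a)" using u assms by auto
  moreover have "Im q = secant a b (Re q)"
    unfolding q secant_def by (simp add: algebra_simps power2_eq_square)
  ultimately show "a \<le> Re q \<and> Re q \<le> b \<and> Im q = secant a b (Re q)" by simp
next
  assume q: "a \<le> Re q \<and> Re q \<le> b \<and> Im q = secant a b (Re q)"
  define u where "u = (Re q - a) / (b - a)"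
  have u: "0 \<le> u" "u \<le> 1" "Re q = a + u * (b - a)" using q assms by (auto simp: u_def)
  have "q = (1 - u) *\<^sub>R parabola a + u *\<^sub>R parabola b"
  proof (rule complex_eqI)
    show "Re q = Re ((1 - u) *\<^sub>R parabola a + u *\<^sub>R parabola b)" using u(3) by (simp add: algebra_simps)
    have "Im q = secant a b (a + u * (b - a))" using q u(3) by simp
    then show "Im q = Im ((1 - u) *\<^sub>R parabola a + u *\<^sub>R parabola b)"
      by (simp add: secant_def algebra_simps power2_eq_square)
  qed
  then show "q \<in> closed_segment (parabola a) (parabola b)" using u by (auto simp: in_segment)
qed

text \<open>
  For increasing \<open>s\<close>, the convex hull of the points of the parabola over \<open>s 0, \<dots>, s l\<close>, described as an intersection of
  half-planes. It serves for the whole drawing and, with \<open>l = 2\<close>, for the triangular faces.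
\<close>

definition polygon :: "(nat \<Rightarrow> real) \<Rightarrow> nat \<Rightarrow> complex set" where
  "polygon s l = {q. Im q \<le> secant (s 0) (s l) (Re q) \<and> (\<forall>t<l. secant (s t) (s (Suc t)) (Re q) \<le> Im q)}"

definition open_polygon :: "(nat \<Rightarrow> real) \<Rightarrow> nat \<Rightarrow> complex set" where
  "open_polygon s l = {q. Im q < secant (s 0) (s l) (Re q) \<and> (\<forall>t<l. secant (s t) (s (Suc t)) (Re q) < Im q)}"

definition polygon_boundary :: "(nat \<Rightarrow> real) \<Rightarrow> nat \<Rightarrow> complex set" where
  "polygon_boundary s l = closed_segment (parabola (s 0)) (parabola (s l)) \<union>
     (\<Union>t<l. closed_segment (parabola (s t)) (parabola (s (Suc t))))"

lemma halfplanes: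
  shows "{q. Im q \<le> secant a b (Re q)} = {q. Complex (- (a + b)) 1 \<bullet> q \<le> - a * b}"
    and "{q. secant a b (Re q) \<le> Im q} = {q. Complex (- (a + b)) 1 \<bullet> q \<ge> - a * b}"
    and "{q. Im q < secant a b (Re q)} = {q. Complex (- (a + b)) 1 \<bullet> q < - a * b}"
    and "{q. secant a b (Re q) < Im q} = {q. Complex (- (a + b)) 1 \<bullet> q > - a * b}"
  by (auto simp: secant_def inner_complex_def algebra_simps)

lemma polygon_Int:
  "polygon s l = {q. Im q \<le> secant (s 0) (s l) (Re q)} \<inter> (\<Inter>t<l. {q. secant (s t) (s (Suc t)) (Re q) \<le> Im q})"
  "open_polygon s l = {q. Im q < secant (s 0) (s l) (Re q)} \<inter> (\<Inter>t<l. {q. secant (s t) (s (Suc t)) (Re q) < Im q})"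
  by (auto simp: polygon_def open_polygon_def)

lemma closed_polygon: "closed (polygon s l)"
  unfolding polygon_Int halfplanes
  by (intro closed_Int closed_INT ballI closed_halfspace_le closed_halfspace_ge)

lemma convex_polygon: "convex (polygon s l)"
  unfolding polygon_Int halfplanes
  by (intro convex_Int convex_INT convex_halfspace_le convex_halfspace_ge)

lemma convex_open_polygon: "convex (open_polygon s l)"
  unfolding polygon_Int halfplanes
  by (intro convex_Int convex_INT convex_halfspace_lt convex_halfspace_gt)

lemma open_open_polygon: "open (open_polygon s l)"
  unfolding polygon_Int halfplanes
  by (intro open_Int open_INT ballI open_halfspace_lt open_halfspace_gt) auto

lemma interior_polygon: "interior (polygon s l) = open_polygon s l"
proof
  show "open_polygon s l \<subseteq> interior (polygon s l)"
    by (rule interior_maximal[OF _ open_open_polygon])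
       (auto simp: polygon_def open_polygon_def intro: less_imp_le)
  show "interior (polygon s l) \<subseteq> open_polygon s l"
  proof
    fix q assume "q \<in> interior (polygon s l)"
    then obtain e where e: "e > 0" "cball q e \<subseteq> polygon s l" by (auto simp: mem_interior_cball)
    have "q + Complex 0 e \<in> polygon s l" "q - Complex 0 e \<in> polygon s l"
      using e by (auto intro!: subsetD[OF e(2)] simp: dist_norm complex_norm)
    then show "q \<in> open_polygon s l" using e(1) unfolding polygon_def open_polygon_def by force
  qed
qed

context
  fixes s :: "nat \<Rightarrow> real" and l :: nat
  assumes mono: "strict_mono s" and l: "2 \<le> l"
begin

lemma s_less: "s i < s j \<longleftrightarrow> i < j" and s_le: "s i \<le> s j \<longleftrightarrow> i \<le> j"
  using mono by (simp_all add: strict_mono_less strict_mono_less_eq)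

lemma polygon_Re:
  assumes "q \<in> polygon s l" shows "s 0 \<le> Re q" "Re q \<le> s l"
proof -
  note [simp] = s_less s_le
  have q: "Im q \<le> secant (s 0) (s l) (Re q)" "secant (s 0) (s 1) (Re q) \<le> Im q"
      "secant (s (l - 1)) (s l) (Re q) \<le> Im q"
    using assms l by (auto simp: polygon_def dest: spec[of _ 0] spec[of _ "l - 1"])
  show "s 0 \<le> Re q" using q(1,2) secant_first[of "s 1" "s l" "Re q" "s 0"] l by force
  show "Re q \<le> s l" using q(1,3) secant_last[of "s 0" "s (l - 1)" "s l" "Re q"] l by force
qed

lemma bounded_polygon: "bounded (polygon s l)"
proof -
  note [simp] = s_less s_le
  define B where "B = \<bar>s 0\<bar> + \<bar>s l\<bar>"
  define C where "C = (\<lambda>a b. \<bar>a + b\<bar> * B + \<bar>a * b\<bar>)"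
  have C: "\<bar>secant a b x\<bar> \<le> C a b" if "\<bar>x\<bar> \<le> B" for a b x
  proof -
    have "\<bar>secant a b x\<bar> \<le> \<bar>(a + b) * x\<bar> + \<bar>a * b\<bar>" unfolding secant_def by (rule abs_triangle_ineq4)
    also have "\<bar>(a + b) * x\<bar> \<le> \<bar>a + b\<bar> * B" using that by (simp add: abs_mult mult_left_mono)
    finally show ?thesis by (simp add: C_def)
  qed
  have "norm q \<le> B + (C (s 0) (s l) + C (s 0) (s 1))" if q: "q \<in> polygon s l" for q
  proof -
    have x: "\<bar>Re q\<bar> \<le> B" using polygon_Re[OF q] by (auto simp: B_def)
    have "Im q \<le> secant (s 0) (s l) (Re q)" "secant (s 0) (s 1) (Re q) \<le> Im q"
      using q l by (auto simp: polygon_def dest: spec[of _ 0])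
    then have "\<bar>Im q\<bar> \<le> C (s 0) (s l) + C (s 0) (s 1)" using C[OF x, of "s 0" "s l"] C[OF x, of "s 0" "s 1"] by linarith
    then show ?thesis using cmod_le[of q] x by linarith
  qed
  then show ?thesis by (auto simp: bounded_iff)
qed

lemma secant_between:
  assumes "t < l" "s i \<le> x" "x \<le> s j"
  shows "secant (s t) (s (Suc t)) x \<le> secant (s i) (s j) x"
proof (cases "i \<le> t \<and> Suc t \<le> j \<and> s t \<le> x \<and> x \<le> s (Suc t)")
  note [simp] = s_less s_le
  case True
  then show ?thesis by (intro secant_mono) auto
next
  case False
  note [simp] = s_less s_le
  have "i \<le> t" if "x < s (Suc t)"
    using le_less_trans[OF assms(2) that] by simp
  moreover have "Suc t \<le> j" if "s t < x"
    using less_le_trans[OF that assms(3)] by simp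
  ultimately have "x \<le> s t \<or> s (Suc t) \<le> x" using False by (meson less_imp_le not_le)
  then have "secant (s t) (s (Suc t)) x \<le> x\<^sup>2" by (intro secant_below) auto
  also have "\<dots> \<le> secant (s i) (s j) x" using assms by (intro secant_above)
  finally show ?thesis .
qed

lemma segment_subset_polygon:
  assumes "i < j" "j \<le> l"
  shows "closed_segment (parabola (s i)) (parabola (s j)) \<subseteq> polygon s l"
proof
  note [simp] = s_less s_le
  fix q assume "q \<in> closed_segment (parabola (s i)) (parabola (s j))"
  then have q: "s i \<le> Re q" "Re q \<le> s j" "Im q = secant (s i) (s j) (Re q)"
    using segment_parabola[of "s i" "s j" q] assms by auto
  then show "q \<in> polygon s l"
    unfolding polygon_def using assms secant_between[of _ i "Re q" j] secant_mono[of "s 0" "s i" "Re q" "s j" "s l"]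
    by auto
qed

text \<open>
  A point of the polygon on the line through two consecutive corners lies between these corners: beyond
  one of them the next side, or else the bound on the abscissa, would exclude it.
\<close>

lemma frontier_polygon: "frontier (polygon s l) = polygon_boundary s l"
proof -
  note [simp] = s_less s_le
  have "frontier (polygon s l) = polygon s l - open_polygon s l"
    by (simp add: frontier_def closed_polygon interior_polygon)
  also have "\<dots> = polygon_boundary s l"
  proof
    show "polygon s l - open_polygon s l \<subseteq> polygon_boundary s l"
    proof
      fix q assume "q \<in> polygon s l - open_polygon s l"
      then have q: "q \<in> polygon s l" and no: "q \<notin> open_polygon s l" by auto
      from q no have "Im q = secant (s 0) (s l) (Re q) \<or> (\<exists>t<l. Im q = secant (s t) (s (Suc t)) (Re q))"
        unfolding polygon_def open_polygon_def mem_Collect_eq by (metis order_le_less)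
      then show "q \<in> polygon_boundary s l"
      proof (elim disjE exE conjE)
        assume "Im q = secant (s 0) (s l) (Re q)"
        then have "q \<in> closed_segment (parabola (s 0)) (parabola (s l))"
          using polygon_Re[OF q] segment_parabola[of "s 0" "s l" q] l by simp
        then show ?thesis by (simp add: polygon_boundary_def)
      next
        fix t assume t: "t < l" "Im q = secant (s t) (s (Suc t)) (Re q)"
        have q': "\<And>r. r < l \<Longrightarrow> secant (s r) (s (Suc r)) (Re q) \<le> Im q" using q by (auto simp: polygon_def)
        have "Re q \<le> s (Suc t)"
        proof (cases "Suc t < l")
          case True
          then show ?thesis using q'[of "Suc t"] t secant_right_less[of "s t" "s (Suc t)" "s (Suc (Suc t))" "Re q"]
            by (force simp: not_less[symmetric])
        next
          case False
          then have "l = Suc t" using t by simp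
          then show ?thesis using polygon_Re[OF q] by simp
        qed
        moreover have "s t \<le> Re q"
        proof (cases t)
          case 0
          then show ?thesis using polygon_Re[OF q] by simp
        next
          case (Suc r)
          then show ?thesis using q'[of r] t secant_left_less[of "s r" "s t" "s (Suc t)" "Re q"]
            by (force simp: not_less[symmetric])
        qed
        ultimately have "q \<in> closed_segment (parabola (s t)) (parabola (s (Suc t)))"
          using segment_parabola[of "s t" "s (Suc t)" q] t by simp
        then show ?thesis using t by (auto simp: polygon_boundary_def)
      qed
    qed
    show "polygon_boundary s l \<subseteq> polygon s l - open_polygon s l"
    proof
      fix q assume q: "q \<in> polygon_boundary s l"
      then consider "q \<in> closed_segment (parabola (s 0)) (parabola (s l))"
        | t where "t < l" "q \<in> closed_segment (parabola (s t)) (parabola (s (Suc t)))"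
        by (auto simp: polygon_boundary_def)
      then show "q \<in> polygon s l - open_polygon s l"
      proof cases
        case 1
        then have "q \<in> polygon s l" using segment_subset_polygon[of 0 l] l by auto
        moreover have "Im q = secant (s 0) (s l) (Re q)"
          using 1 segment_parabola[of "s 0" "s l" q] l by simp
        ultimately show ?thesis by (simp add: open_polygon_def)
      next
        case 2
        then have "q \<in> polygon s l" using segment_subset_polygon[of t "Suc t"] by auto
        moreover have "Im q = secant (s t) (s (Suc t)) (Re q)"
          using 2 segment_parabola[of "s t" "s (Suc t)" q] by simp
        ultimately show ?thesis using 2 by (auto simp: open_polygon_def)
      qed
    qed
  qed
  finally show ?thesis .
qed

lemma frontier_open_polygon:
  assumes "open_polygon s l \<noteq> {}"
  shows "frontier (open_polygon s l) = polygon_boundary s l"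
proof -
  have "closure (open_polygon s l) = closure (polygon s l)"
    using convex_closure_interior[OF convex_polygon] assms by (simp add: interior_polygon)
  then have "frontier (open_polygon s l) = frontier (polygon s l)"
    by (simp add: frontier_def interior_polygon interior_open open_open_polygon)
  then show ?thesis by (simp add: frontier_polygon)
qed

end

lemma component_eqI:
  assumes "F \<in> components (- S)" "q \<in> F" "q \<in> X" "connected X" "X \<inter> S = {}" "frontier X \<subseteq> S"
  shows "F = X"
proof
  show "X \<subseteq> F"
    by (rule components_maximal[OF assms(1,4)]) (use assms in auto)
  show "F \<subseteq> X"
  proof (rule ccontr)
    assume "\<not> F \<subseteq> X"
    then have "F - X \<noteq> {}" "F \<inter> X \<noteq> {}" using assms by auto
    then have "F \<inter> frontier X \<noteq> {}"
      using in_components_connected[OF assms(1)] by (intro connected_Int_frontier)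
    then show False using in_components_subset[OF assms(1)] assms(6) by blast
  qed
qed

definition node :: "nat \<Rightarrow> complex" where
  "node i = parabola (real i)"

lemma node_eq_iff [simp]: "node i = node j \<longleftrightarrow> i = j" by (simp add: node_def)

text \<open>
  An edge is an unordered pair of points, so the direction of its linepath has to be chosen.
\<close>

definition drawing :: "nat \<Rightarrow> (nat \<times> nat) set \<Rightarrow> plane_graph" where
  "drawing n E = \<lparr>verts = node ` {..<n}, edges = {{node i, node j} | i j. (i, j) \<in> E},
     curve = (\<lambda>e. case (SOME (a, b). e = {a, b}) of (a, b) \<Rightarrow> linepath a b)\<rparr>"

lemma drawing_simps [simp]:
  "verts (drawing n E) = node ` {..<n}" "edges (drawing n E) = {{node i, node j} | i j. (i, j) \<in> E}"
  by (simp_all add: drawing_def)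

lemma curve_drawing:
  obtains a b where "{a, b} = {u, v}" "curve (drawing n E) {u, v} = linepath a b"
proof -
  obtain a b where ab: "(SOME (a, b). {u, v} = {a, b}) = (a, b)" by fastforce
  have "case (SOME (a, b). {u, v} = {a, b}) of (a, b) \<Rightarrow> {u, v} = {a, b}"
    by (rule someI[of "\<lambda>(a, b). {u, v} = {a, b}" "(u, v)"]) simp
  then show ?thesis using that[of a b] ab by (simp add: drawing_def)
qed

lemma curve_image: "path_image (curve (drawing n E) {u, v}) = closed_segment u v"
proof -
  obtain a b where "{a, b} = {u, v}" "curve (drawing n E) {u, v} = linepath a b"
    by (rule curve_drawing)
  then show ?thesis by (auto simp: doubleton_eq_iff closed_segment_commute)
qed

lemma curve_arc:
  assumes "u \<noteq> v"
  shows "arc (curve (drawing n E) {u, v})"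
    "{pathstart (curve (drawing n E) {u, v}), pathfinish (curve (drawing n E) {u, v})} = {u, v}"
proof -
  obtain a b where "{a, b} = {u, v}" "curve (drawing n E) {u, v} = linepath a b"
    by (rule curve_drawing)
  then show "arc (curve (drawing n E) {u, v})"
    "{pathstart (curve (drawing n E) {u, v}), pathfinish (curve (drawing n E) {u, v})} = {u, v}"
    using assms by (auto simp: doubleton_eq_iff arc_linepath)
qed

locale drawn_polygon = triangulated_polygon "{..<n}" E for n :: nat and E +
  assumes n: "3 \<le> n"
begin

abbreviation G where "G \<equiv> drawing n E"

abbreviation seg where "seg i j \<equiv> closed_segment (node i) (node j)"

lemma edge_less: "(a, b) \<in> E \<Longrightarrow> a < b \<and> b < n" using edge_verts by auto

lemma mem_seg:
  "a < b \<Longrightarrow> q \<in> seg a b \<longleftrightarrow> real a \<le> Re q \<and> Re q \<le> real b \<and> Im q = secant a b (Re q)"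
  unfolding node_def by (rule segment_parabola) simp

lemma laminar:
  assumes "(a, b) \<in> E" "(c, d) \<in> E"
  shows "a \<le> c \<and> d \<le> b \<or> c \<le> a \<and> b \<le> d \<or> b \<le> c \<or> d \<le> a"
  using noncrossing[OF assms] noncrossing[OF assms(2,1)] by linarith

lemma support_drawing: "support G = (\<Union>(a, b)\<in>E. seg a b) \<union> node ` {..<n}"
proof -
  have "(\<Union>e\<in>edges G. path_image (curve G e)) = (\<Union>(a, b)\<in>E. path_image (curve G {node a, node b}))"
    by auto
  then show ?thesis by (simp only: support_def curve_image drawing_simps Un_commute)
qed

lemma seg_support: "(a, b) \<in> E \<Longrightarrow> seg a b \<subseteq> support G"
  unfolding support_drawing by blast

lemma segments_meet:
  assumes "(a, b) \<in> E" "(c, d) \<in> E" "(a, b) \<noteq> (c, d)" "q \<in> seg a b" "q \<in> seg c d"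
  shows "q \<in> {node a, node b}"
proof -
  have ab: "a < b" and cd: "c < d" using assms edge_less by auto
  note q = assms(4)[unfolded mem_seg[OF ab]] assms(5)[unfolded mem_seg[OF cd]]
  have "Re q = real a \<or> Re q = real b"
    using laminar[OF assms(1,2)]
  proof (elim disjE conjE)
    assume "a \<le> c" "d \<le> b"
    then show ?thesis using secant_eq_nested[of a c "Re q" d b] q assms(3) by auto
  next
    assume le: "c \<le> a" "b \<le> d"
    then have "Re q = real c \<or> Re q = real d"
      using secant_eq_nested[of c a "Re q" b d] q assms(3) by auto
    then show ?thesis using q le by auto
  qed (use q in auto)
  then show ?thesis
    using q by (auto simp: node_def complex_eq_iff secant_def power2_eq_square algebra_simps)
qed

lemma node_on_segment:
  assumes "(a, b) \<in> E" "node m \<in> seg a b"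
  shows "m = a \<or> m = b"
proof -
  have "a < b" using assms edge_less by auto
  then have "real m * real m = secant a b m" using assms(2) mem_seg[of a b "node m"] by (simp add: node_def power2_eq_square)
  then have "(real m - a) * (b - real m) = 0" by (simp add: secant_def algebra_simps)
  then show ?thesis by auto
qed

lemma plane_drawing: "plane G"
  unfolding plane_def
proof (intro conjI ballI impI)
  have "card {node i, node j} = 2" if "(i, j) \<in> E" for i j
    using edge_less[OF that] by simp
  then show "simple_graph G" using edge_verts by (auto simp: simple_graph_def)
next
  fix e assume "e \<in> edges G"
  then obtain a b where ab: "(a, b) \<in> E" "e = {node a, node b}" by auto
  then have "a \<noteq> b" using edge_less by auto
  then show "arc (curve G e)" "{pathstart (curve G e), pathfinish (curve G e)} = e"
    using curve_arc[of "node a" "node b" n E] ab by auto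
  show "(path_image (curve G e) - e) \<inter> verts G = {}"
    using node_on_segment[OF ab(1)] ab(2) by (auto simp: curve_image)
  fix f assume "f \<in> edges G" "e \<noteq> f"
  then obtain c d where cd: "(c, d) \<in> E" "f = {node c, node d}" by auto
  then have "(a, b) \<noteq> (c, d)" using \<open>e \<noteq> f\<close> ab by auto
  then show "(path_image (curve G e) - e) \<inter> path_image (curve G f) = {}"
    using segments_meet[OF ab(1) cd(1)] ab(2) cd(2) by (auto simp: curve_image)
qed

definition triangle :: "nat \<Rightarrow> nat \<Rightarrow> nat \<Rightarrow> complex set" where
  "triangle i z j = {q. Im q < secant i j (Re q) \<and> secant i z (Re q) < Im q \<and> secant z j (Re q) < Im q}"

text \<open>
  The values of \<open>s\<close> beyond 2 only serve to make it strictly increasing.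
\<close>

lemma triangle_polygon:
  assumes "i < z" "z < j"
  obtains s where "strict_mono s" "open_polygon s 2 = triangle i z j"
    "polygon_boundary s 2 = seg i j \<union> seg i z \<union> seg z j"
proof -
  define s where "s = (\<lambda>t::nat. if t = 0 then real i else if t = 1 then real z else real j + real (t - 2))"
  have "strict_mono s"
    unfolding strict_mono_Suc_iff using assms by (auto simp: s_def)
  moreover have "open_polygon s 2 = triangle i z j"
    by (auto simp: open_polygon_def triangle_def s_def numeral_2_eq_2 less_Suc_eq)
  moreover have "polygon_boundary s 2 = seg i j \<union> seg i z \<union> seg z j"
    by (auto simp: polygon_boundary_def node_def s_def numeral_2_eq_2 less_Suc_eq lessThan_Suc)
  ultimately show ?thesis using that by blast
qed

lemma triangle_Int_segment:
  assumes "(i, j) \<in> E" "(i, z) \<in> E" "(z, j) \<in> E" "(a, b) \<in> E"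
  shows "triangle i z j \<inter> seg a b = {}"
proof (rule ccontr)
  assume "triangle i z j \<inter> seg a b \<noteq> {}"
  then obtain q where q: "q \<in> triangle i z j" "q \<in> seg a b" by blast
  have less: "a < b" "i < z" "z < j" using assms edge_less by auto
  let ?x = "Re q"
  have qt: "Im q < secant i j ?x" "secant i z ?x < Im q" "secant z j ?x < Im q" using q by (auto simp: triangle_def)
  have qs: "real a \<le> ?x" "?x \<le> b" "Im q = secant a b ?x" using q(2) mem_seg[OF less(1)] by auto
  have "\<not> ?x \<le> i"
  proof
    assume "?x \<le> i"
    then have "secant i j ?x \<le> secant i z ?x"
      using secant_first[of z j ?x i] less by (cases "?x = i") (auto simp: secant_eq)
    then show False using qt by simp
  qed
  moreover have "\<not> j \<le> ?x"
  proof
    assume "j \<le> ?x"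
    then have "secant i j ?x \<le> secant z j ?x"
      using secant_last[of i z j ?x] less by (cases "?x = j") (auto simp: secant_eq)
    then show False using qt by simp
  qed
  ultimately have x: "i < ?x" "?x < j" by simp_all
  have out: "\<not> (a \<le> i \<and> j \<le> b)" using secant_mono[of a i ?x j b] qs x qt by auto
  have in1: "\<not> (i \<le> a \<and> b \<le> z)" using secant_mono[of i a ?x b z] qs qt by auto
  have in2: "\<not> (z \<le> a \<and> b \<le> j)" using secant_mono[of z a ?x b j] qs qt by auto
  have "\<not> b \<le> i" "\<not> j \<le> a" using x qs by auto
  then show False
    using out in1 in2 laminar[OF assms(4,1)] laminar[OF assms(4,2)] laminar[OF assms(4,3)] less by linarith
qed

text \<open>
  Descend through the triangulation: a point below the edge \<open>(i, j)\<close> is in the triangle on this edge,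
  or on or below one of the other two sides of the triangle.
\<close>

lemma covered:
  assumes "(i, j) \<in> E" "real i \<le> Re q" "Re q \<le> real j" "Im q \<le> secant i j (Re q)"
    and "\<And>t. Suc t < n \<Longrightarrow> secant t (Suc t) (Re q) \<le> Im q"
  shows "q \<in> support G \<or> (\<exists>a z b. (a, z) \<in> E \<and> (z, b) \<in> E \<and> (a, b) \<in> E \<and> q \<in> triangle a z b)"
  using assms(1-4)
proof (induction "j - i" arbitrary: i j rule: less_induct)
  case less
  have ij: "i < j" "j < n" using edge_less less.prems by auto
  consider "Im q = secant i j (Re q)" | "Im q < secant i j (Re q)" "Suc i < j" | "j = Suc i" "Im q < secant i j (Re q)"
    using less.prems ij by linarith
  then show ?case
  proof cases
    case 1
    then have "q \<in> seg i j" using less.prems mem_seg[OF ij(1)] by simp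
    then show ?thesis using less.prems(1) by (auto simp: support_drawing)
  next
    case 2
    then obtain z where z: "i < z" "z < j" "(i, z) \<in> E" "(z, j) \<in> E"
      using apex[OF less.prems(1), of "Suc i"] ij by auto
    consider "Re q \<le> z" "Im q \<le> secant i z (Re q)" | "z \<le> Re q" "Im q \<le> secant z j (Re q)"
      | "Re q \<le> z" "secant i z (Re q) < Im q" | "z \<le> Re q" "secant z j (Re q) < Im q" by linarith
    then show ?thesis
    proof cases
      case 1
      then show ?thesis using less.hyps[OF _ z(3)] less.prems z by simp
    next
      case 2
      then show ?thesis using less.hyps[OF _ z(4)] less.prems z by simp
    next
      case 3
      then have "q \<in> triangle i z j"
        using \<open>Im q < _\<close> secant_left[of i z j "Re q"] z by (auto simp: triangle_def)
      then show ?thesis using z less.prems by blast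
    next
      case 4
      then have "q \<in> triangle i z j"
        using \<open>Im q < _\<close> secant_right[of i z j "Re q"] z by (auto simp: triangle_def)
      then show ?thesis using z less.prems by blast
    qed
  next
    case 3
    then show ?thesis using assms(5)[of i] ij by simp
  qed
qed

definition region :: "complex set" where
  "region = polygon real (n - 1)"

lemma real_mono: "strict_mono real" by (simp add: strict_mono_def)

lemma two_le_pred_n: "2 \<le> n - 1" using n by simp

lemma root_edge: "(0, n - 1) \<in> E"
proof -
  have "Min {..<n} = 0" "Max {..<n} = n - 1"
    using n by (auto intro!: Min_eqI Max_eqI)
  then show ?thesis using root by simp
qed

text \<open>
  The shortest edge around \<open>t\<close> and \<open>Suc t\<close> has no apex, so it joins these two.
\<close>

lemma side_edge: "Suc t < n \<Longrightarrow> (t, Suc t) \<in> E"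
proof -
  assume t: "Suc t < n"
  let ?P = "\<lambda>e. e \<in> E \<and> fst e \<le> t \<and> Suc t \<le> snd e"
  obtain e where e: "?P e" "\<forall>f. ?P f \<longrightarrow> snd e - fst e \<le> snd f - fst f"
  proof -
    have "?P (0, n - 1)" using root_edge t by simp
    from ex_has_least_nat[of ?P, OF this, of "\<lambda>e. snd e - fst e"] show ?thesis using that by blast
  qed
  obtain a b where ab: "e = (a, b)" by (cases e)
  have "\<not> (a < t \<or> Suc t < b)"
  proof
    assume "a < t \<or> Suc t < b"
    then obtain z where z: "a < z" "z < b" "(a, z) \<in> E" "(z, b) \<in> E"
      using apex[of a b t] apex[of a b "Suc t"] e(1) t ab by auto
    then have "b - a \<le> z - a \<or> b - a \<le> b - z"
      using e(1) e(2)[rule_format, of "(a, z)"] e(2)[rule_format, of "(z, b)"] ab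
      by (cases "Suc t \<le> z") auto
    then show False using z(1,2) by linarith
  qed
  then show ?thesis using e(1) ab by auto
qed

lemma frontier_region: "frontier region = seg 0 (n - 1) \<union> (\<Union>t<n - 1. seg t (Suc t))"
  unfolding region_def frontier_polygon[OF real_mono two_le_pred_n] polygon_boundary_def node_def by simp

lemma frontier_region_support: "frontier region \<subseteq> support G"
proof -
  have "seg t (Suc t) \<subseteq> support G" if "t < n - 1" for t
    using side_edge[of t] that by (intro seg_support) simp
  then show ?thesis unfolding frontier_region using seg_support[OF root_edge] by blast
qed

lemma nodes_frontier: "node ` {..<n} \<subseteq> frontier region"
proof
  fix v assume "v \<in> node ` {..<n}"
  then obtain i where i: "i < n" "v = node i" by auto
  show "v \<in> frontier region"
  proof (cases "i = n - 1")
    case True then show ?thesis using i by (simp add: frontier_region)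
  next
    case False
    then have "v \<in> seg i (Suc i)" "i < n - 1" using i by auto
    then show ?thesis unfolding frontier_region by blast
  qed
qed

lemma support_region: "support G \<subseteq> region"
proof -
  have cl: "closed region" unfolding region_def by (rule closed_polygon)
  then have "frontier region \<subseteq> region" by (simp add: frontier_subset_eq)
  moreover have "seg a b \<subseteq> region" if "(a, b) \<in> E" for a b
  proof -
    have "a < b" "b \<le> n - 1" using edge_less[OF that] by auto
    then show ?thesis
      using segment_subset_polygon[OF real_mono two_le_pred_n] unfolding region_def node_def by blast
  qed
  ultimately show ?thesis using nodes_frontier unfolding support_drawing by blast
qed

lemma bounded_region: "bounded region" unfolding region_def by (rule bounded_polygon[OF real_mono two_le_pred_n])

lemma convex_region: "convex region" unfolding region_def by (rule convex_polygon)

lemma face_outside: "F \<in> faces G \<Longrightarrow> q \<in> F \<Longrightarrow> q \<notin> region \<Longrightarrow> F = - region"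
  unfolding faces_def
  using support_region frontier_region_support bounded_region convex_region
  by (intro component_eqI[of F "support G" q])
     (auto simp: frontier_complement intro!: connected_complement_bounded_convex)

text \<open>
  The open triangles are connected, avoid the drawing and have their frontiers in it, so they are faces;
  and by \<open>covered\<close> they exhaust the convex hull of the drawing up to the drawing itself.
\<close>

lemma face_triangle:
  assumes "F \<in> faces G" "q \<in> F" "q \<in> region"
  obtains a z b where "(a, z) \<in> E" "(z, b) \<in> E" "(a, b) \<in> E" "F = triangle a z b" "q \<in> triangle a z b"
proof -
  have "q \<notin> support G" using assms in_components_subset by (fastforce simp: faces_def)
  have "secant t (Suc t) (Re q) \<le> Im q" if "Suc t < n" for t
    using assms(3) that by (simp add: region_def polygon_def)
  moreover have "0 \<le> Re q" "Re q \<le> real (n - 1)" "Im q \<le> secant 0 (n - 1) (Re q)"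
    using polygon_Re[OF real_mono two_le_pred_n, of q] assms(3) by (auto simp: region_def polygon_def)
  ultimately obtain a z b where azb: "(a, z) \<in> E" "(z, b) \<in> E" "(a, b) \<in> E" "q \<in> triangle a z b"
    using covered[OF root_edge, of q] \<open>q \<notin> support G\<close> by auto
  have less: "a < z" "z < b" using azb edge_less by auto
  obtain s where s: "strict_mono s" "open_polygon s 2 = triangle a z b"
    "polygon_boundary s 2 = seg a b \<union> seg a z \<union> seg z b" using triangle_polygon[OF less] .
  have fr: "frontier (triangle a z b) = seg a b \<union> seg a z \<union> seg z b"
    using frontier_open_polygon[OF s(1), of 2] s azb by auto
  have "F = triangle a z b"
  proof (rule component_eqI[of F "support G" q])
    show "connected (triangle a z b)" using convex_open_polygon[of s 2] s(2) convex_connected by simp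
    have "node m \<notin> triangle a z b" if "m < n" for m
    proof -
      obtain c d where "(c, d) \<in> E" "node m \<in> seg c d"
      proof (cases "m = n - 1")
        case True then show ?thesis using that[of 0 "n - 1"] root_edge by auto
      next
        case False then show ?thesis using that[of m "Suc m"] side_edge[of m] \<open>m < n\<close> by auto
      qed
      then show ?thesis using triangle_Int_segment azb by blast
    qed
    then show "triangle a z b \<inter> support G = {}"
      using triangle_Int_segment[OF azb(3,1,2)] unfolding support_drawing by blast
    show "frontier (triangle a z b) \<subseteq> support G" unfolding fr support_drawing using azb by blast
  qed (use assms azb in \<open>auto simp: faces_def\<close>)
  then show ?thesis using that azb by blast
qed

lemma exterior_drawing: "exterior_face G = - region"
proof -
  have ub: "\<not> bounded (exterior_face G)" and f: "exterior_face G \<in> faces G"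
    using exterior_face_unique(1,2)[OF plane_drawing] by auto
  then have "\<not> exterior_face G \<subseteq> region" using bounded_subset[OF bounded_region] by blast
  then obtain q where "q \<in> exterior_face G" "q \<notin> region" by blast
  then show ?thesis using face_outside f by blast
qed

lemma mop_G: "mop G"
  unfolding mop_def triangulated_disc_def
proof (intro conjI ballI impI)
  show "plane G" by (rule plane_drawing)
  show "verts G \<subseteq> frontier (exterior_face G)"
    using nodes_frontier by (simp add: exterior_drawing frontier_complement)
  have "bounded_by_cycle G (exterior_face G) (map node [0..<n])"
  proof -
    let ?p = "map node [0..<n]"
    have ce: "cycle_edges ?p = insert {node 0, node (n - 1)} ((\<lambda>t. {node t, node (Suc t)}) ` {..<n - 1})"
    proof -
      have "cycle_edges ?p = (\<lambda>t. {node t, node (Suc t mod n)}) ` {..<n}"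
        unfolding cycle_edges_eq_image by (rule image_cong) (use n in auto)
      also have "{..<n} = insert (n - 1) {..<n - 1}" using n by auto
      also have "(\<lambda>t. {node t, node (Suc t mod n)}) ` \<dots> =
          insert {node 0, node (n - 1)} ((\<lambda>t. {node t, node (Suc t)}) ` {..<n - 1})"
        using n by (auto simp: insert_commute image_iff Suc_diff_Suc)
      finally show ?thesis .
    qed
    have "cycle_edges ?p \<subseteq> edges G" unfolding ce using root_edge side_edge by fastforce
    then have "is_cycle G ?p" using n by (auto simp: is_cycle_def distinct_map inj_on_def)
    moreover have "frontier (exterior_face G) = (\<Union>e\<in>cycle_edges ?p. path_image (curve G e))"
      unfolding exterior_drawing frontier_complement frontier_region ce by (simp add: curve_image)
    ultimately show ?thesis by (simp add: bounded_by_cycle_def)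
  qed
  then show "\<exists>p. bounded_by_cycle G (exterior_face G) p" by blast
next
  fix F assume F: "F \<in> faces G" "F \<noteq> exterior_face G"
  then obtain q where q: "q \<in> F" using in_components_nonempty by (fastforce simp: faces_def)
  then have "q \<in> region" using F face_outside exterior_drawing by blast
  then obtain a z b where azb: "(a, z) \<in> E" "(z, b) \<in> E" "(a, b) \<in> E" "F = triangle a z b" "q \<in> triangle a z b"
    using face_triangle F q by blast
  have less: "a < z" "z < b" "b < n" using azb edge_less by auto
  obtain s where s: "strict_mono s" "open_polygon s 2 = triangle a z b"
    "polygon_boundary s 2 = seg a b \<union> seg a z \<union> seg z b" using triangle_polygon[OF less(1,2)] .
  have fr: "frontier F = seg a b \<union> seg a z \<union> seg z b"
    using frontier_open_polygon[OF s(1), of 2] s azb by auto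
  let ?p = "[node a, node z, node b]"
  have l3: "length ?p = 3" by simp
  have "cycle_edges ?p = (\<lambda>t. {?p ! t, ?p ! (Suc t mod 3)}) ` {..<3}"
    unfolding cycle_edges_eq_image l3 by (rule refl)
  also have "{..<3} = {0, 1, 2::nat}" by auto
  finally have ce: "cycle_edges ?p = {{node a, node z}, {node z, node b}, {node b, node a}}" by simp
  have "{node b, node a} = {node a, node b}" by auto
  then have "cycle_edges ?p \<subseteq> edges G" unfolding ce using azb(1-3) by auto
  then have "is_cycle G ?p" using less by (auto simp: is_cycle_def)
  moreover have "frontier F = (\<Union>e\<in>cycle_edges ?p. path_image (curve G e))"
    unfolding fr ce by (auto simp: curve_image closed_segment_commute)
  ultimately have "bounded_by_cycle G F ?p" by (simp add: bounded_by_cycle_def)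
  then show "\<exists>p. length p = 3 \<and> bounded_by_cycle G F p" by (intro exI[of _ ?p]) simp
qed

end

section \<open>The upper bound for mops\<close>

lemma star_isolatingI:
  assumes "finite (verts G)" "S \<subseteq> verts G"
    and deg: "\<And>u. u \<in> verts G - closed_nbhd G S \<Longrightarrow>
      card {w \<in> verts G - closed_nbhd G S. {u, w} \<in> edges G} \<le> k"
  shows "star_isolating k G S"
  unfolding star_isolating_def
proof (intro conjI notI)
  let ?R = "verts G - closed_nbhd G S"
  assume "contains_copy (induced G ?R) (star (k + 1))"
  then obtain f where inj: "inj_on f (verts (star (k + 1)))"
      and f_verts: "f ` verts (star (k + 1)) \<subseteq> verts (induced G ?R)"
      and f_edges: "\<And>e. e \<in> edges (star (k + 1)) \<Longrightarrow> f ` e \<in> edges (induced G ?R)"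
    unfolding contains_copy_def by blast
  have f: "inj_on f {0..k + 1}" "f ` {0..k + 1} \<subseteq> ?R"
    using inj f_verts by (simp_all add: star_def induced_def)
  have "f ` {0, i} \<in> edges G" if "i \<in> {1..k + 1}" for i
    using f_edges[of "{0, i}"] that by (auto simp: star_def induced_def)
  then have "f ` {1..k + 1} \<subseteq> {w \<in> ?R. {f 0, w} \<in> edges G}" using f(2) by force
  then have "card (f ` {1..k + 1}) \<le> card {w \<in> ?R. {f 0, w} \<in> edges G}"
    using assms(1) by (intro card_mono) auto
  moreover have "card (f ` {1..k + 1}) = k + 1"
    using inj_on_subset[OF f(1), of "{1..k + 1}"] by (simp add: card_image)
  moreover have "f 0 \<in> ?R" by (rule subsetD[OF f(2)], rule imageI) simp
  ultimately show False using deg[of "f 0"] by simp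
qed fact

context mop_drawing
begin

lemma star_isolating_vertices:
  assumes "isolating k {..<n} chords S"
  shows "star_isolating k G ((!) p ` S)"
proof (rule star_isolatingI)
  let ?S = "(!) p ` S" and ?U = "undominated {..<n} chords S"
  have S: "S \<subseteq> {..<n}" using assms by (simp add: isolating_def)
  have inj: "inj_on ((!) p) {..<n}" using cyc by (simp add: is_cycle_def inj_on_nth)
  have verts: "verts G = (!) p ` {..<n}" unfolding verts_eq by (auto simp: set_conv_nth)
  show "finite (verts G)" unfolding verts_eq by simp
  show "?S \<subseteq> verts G" using S unfolding verts by auto
  have R: "verts G - closed_nbhd G ?S = (!) p ` ?U"
  proof -
    have "p ! i \<in> closed_nbhd G ?S \<longleftrightarrow> i \<notin> ?U" if "i < n" for i
    proof -
      have "p ! i \<in> ?S \<longleftrightarrow> i \<in> S" using inj_on_image_mem_iff[OF inj _ S] that by simp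
      moreover have "(\<exists>u\<in>?S. {u, p ! i} \<in> edges G) \<longleftrightarrow> (\<exists>s\<in>S. adj chords s i)"
        using adj_chords[OF _ that] S by auto
      ultimately show ?thesis using that verts by (auto simp: closed_nbhd_def undominated_def)
    qed
    then show ?thesis unfolding verts by (auto simp: undominated_def)
  qed
  fix u assume "u \<in> verts G - closed_nbhd G ?S"
  then obtain i where i: "i \<in> ?U" "u = p ! i" unfolding R by auto
  have U: "?U \<subseteq> {..<n}" by (auto simp: undominated_def)
  have "{w \<in> (!) p ` ?U. {u, w} \<in> edges G} = (!) p ` {j \<in> ?U. adj chords i j}"
    using adj_chords U i by auto
  also have "card \<dots> \<le> card {j \<in> ?U. adj chords i j}"
    using finite_subset[OF U] by (intro card_image_le) simp
  also have "\<dots> \<le> k" using assms i(1) by (simp add: isolating_def)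
  finally show "card {w \<in> verts G - closed_nbhd G ?S. {u, w} \<in> edges G} \<le> k" unfolding R .
qed

lemma iota_le:
  assumes "k + 4 \<le> n"
  shows "iota k G \<le> n div (k + 4)"
proof -
  obtain S where S: "isolating k {..<n} chords S" "card S \<le> max 1 (card {..<n} div (k + 4))"
    using exists_small_isolating[OF triangulated_polygon_chords] by blast
  have "1 \<le> n div (k + 4)" using div_le_mono[OF assms, of "k + 4"] by simp
  have "iota k G \<le> card ((!) p ` S)"
    using iota_attained(2)[OF _ star_isolating_vertices[OF S(1)]] verts_eq by simp
  also have "\<dots> \<le> card S"
    using S(1) finite_subset by (intro card_image_le) (auto simp: isolating_def)
  also have "\<dots> \<le> n div (k + 4)" using S(2) \<open>1 \<le> n div (k + 4)\<close> by simp
  finally show ?thesis .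
qed

end

theorem mop_iota_le:
  assumes "mop G" "k + 4 \<le> graph_order G"
  shows "iota k G \<le> graph_order G div (k + 4)"
proof -
  obtain p where "bounded_by_cycle G (exterior_face G) p"
    using assms(1) by (auto simp: mop_def triangulated_disc_def)
  then interpret mop_drawing G p
    using assms(1) by unfold_locales (auto simp: mop_def triangulated_disc_def)
  have "graph_order G = n"
    using cyc verts_eq by (simp add: graph_order_def is_cycle_def distinct_card)
  then show ?thesis using iota_le[of k] assms(2) by simp
qed

section \<open>Mops attaining the bound\<close>

lemma triangulated_interval:
  fixes i j :: nat
  assumes "i < j" "(i, j) \<in> E" "\<And>a b. (a, b) \<in> E \<Longrightarrow> i \<le> a \<and> a < b \<and> b \<le> j"
    and "\<And>a b. \<lbrakk>(a, b) \<in> E; Suc a < b\<rbrakk> \<Longrightarrow> \<exists>z. a < z \<and> z < b \<and> (a, z) \<in> E \<and> (z, b) \<in> E"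
    and "\<And>a b c d. \<lbrakk>(a, b) \<in> E; (c, d) \<in> E; a < c; c < b\<rbrakk> \<Longrightarrow> d \<le> b"
  shows "triangulated_polygon {i..j} E"
proof
  have "Min {i..j} = i" "Max {i..j} = j" using assms(1) by (auto intro!: Min_eqI Max_eqI)
  then show "(Min {i..j}, Max {i..j}) \<in> E" using assms(2) by simp
  show "a \<in> {i..j} \<and> b \<in> {i..j} \<and> a < b" if "(a, b) \<in> E" for a b using assms(3)[OF that] by auto
  show "\<exists>z. a < z \<and> z < b \<and> (a, z) \<in> E \<and> (z, b) \<in> E" if "(a, b) \<in> E" "a < v" "v < b" for a b v
    using assms(4)[OF that(1)] that by simp
  show "d \<le> b" if "(a, b) \<in> E" "(c, d) \<in> E" "a < c" "c < b" for a b c d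
    using assms(5) that by blast
qed simp

lemma triangulated_intervalD:
  fixes i j :: nat
  assumes "triangulated_polygon {i..j} E" "i < j"
  shows "(i, j) \<in> E" "(a, b) \<in> E \<Longrightarrow> i \<le> a \<and> a < b \<and> b \<le> j"
    "\<lbrakk>(a, b) \<in> E; Suc a < b\<rbrakk> \<Longrightarrow> \<exists>z. a < z \<and> z < b \<and> (a, z) \<in> E \<and> (z, b) \<in> E"
    "\<lbrakk>(a, b) \<in> E; (c, d) \<in> E; a < c; c < b\<rbrakk> \<Longrightarrow> d \<le> b"
proof -
  interpret triangulated_polygon "{i..j}" E by fact
  have "Min {i..j} = i" "Max {i..j} = j" using assms(2) by (auto intro!: Min_eqI Max_eqI)
  then show "(i, j) \<in> E" using root by simp
  show e: "(a, b) \<in> E \<Longrightarrow> i \<le> a \<and> a < b \<and> b \<le> j" for a b using edge_verts by auto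
  show "\<lbrakk>(a, b) \<in> E; Suc a < b\<rbrakk> \<Longrightarrow> \<exists>z. a < z \<and> z < b \<and> (a, z) \<in> E \<and> (z, b) \<in> E"
    using apex[of a b "Suc a"] e[of a b] by simp
  show "\<lbrakk>(a, b) \<in> E; (c, d) \<in> E; a < c; c < b\<rbrakk> \<Longrightarrow> d \<le> b" using noncrossing by blast
qed

lemma triangulated_edge: "triangulated_polygon {i..Suc i} {(i, Suc i)}"
  by (rule triangulated_interval) auto

text \<open>
  Two triangulated polygons that share the vertex \<open>z\<close> are joined by a triangle with apex \<open>z\<close>.
\<close>

lemma triangulated_glue:
  fixes i z j :: nat
  assumes "triangulated_polygon {i..z} E" "triangulated_polygon {z..j} F" "i < z" "z < j"
  shows "triangulated_polygon {i..j} (insert (i, j) (E \<union> F))"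
proof (rule triangulated_interval)
  note E = triangulated_intervalD[OF assms(1,3)] and F = triangulated_intervalD[OF assms(2,4)]
  show "i < j" using assms by simp
  show "i \<le> a \<and> a < b \<and> b \<le> j" if "(a, b) \<in> insert (i, j) (E \<union> F)" for a b
    using that E(2)[of a b] F(2)[of a b] assms(3,4) by auto
  show "\<exists>y. a < y \<and> y < b \<and> (a, y) \<in> insert (i, j) (E \<union> F) \<and> (y, b) \<in> insert (i, j) (E \<union> F)"
    if "(a, b) \<in> insert (i, j) (E \<union> F)" "Suc a < b" for a b
  proof -
    consider "(a, b) = (i, j)" | "(a, b) \<in> E" | "(a, b) \<in> F" using \<open>(a, b) \<in> _\<close> by blast
    then show ?thesis
    proof cases
      case 1 then show ?thesis using E(1) F(1) assms(3,4) by (intro exI[of _ z]) simp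
    next
      case 2 then show ?thesis using E(3)[OF 2 that(2)] by blast
    next
      case 3 then show ?thesis using F(3)[OF 3 that(2)] by blast
    qed
  qed
  show "d \<le> b" if "(a, b) \<in> insert (i, j) (E \<union> F)" "(c, d) \<in> insert (i, j) (E \<union> F)" "a < c" "c < b" for a b c d
  proof -
    consider "(a, b) = (i, j)" | "(c, d) = (i, j)" | "(a, b) \<in> E" "(c, d) \<in> E" | "(a, b) \<in> F" "(c, d) \<in> F"
      | "(a, b) \<in> E" "(c, d) \<in> F" | "(a, b) \<in> F" "(c, d) \<in> E"
      using \<open>(a, b) \<in> _\<close> \<open>(c, d) \<in> _\<close> by blast
    then show ?thesis
    proof cases
      case 1 then show ?thesis using that(2) E(2)[of c d] F(2)[of c d] assms(3,4) by auto
    next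
      case 2 then show ?thesis using that E(2)[of a b] F(2)[of a b] assms(3,4) by auto
    next
      case 3 then show ?thesis using E(4) that(3,4) by blast
    next
      case 4 then show ?thesis using F(4) that(3,4) by blast
    next
      case 5 then show ?thesis using E(2)[of a b] F(2)[of c d] that by simp
    next
      case 6 then show ?thesis using F(2)[of a b] E(2)[of c d] that by simp
    qed
  qed
qed simp

text \<open>
  The polygon \<open>c, c + 1, \<dots>, c + r + 1\<close> with all diagonals at \<open>c\<close>.
\<close>

fun fan :: "nat \<Rightarrow> nat \<Rightarrow> (nat \<times> nat) set" where
  "fan c 0 = {(c, Suc c)}"
| "fan c (Suc r) = insert (c, c + r + 2) (fan c r \<union> {(c + r + 1, c + r + 2)})"

lemma triangulated_fan: "triangulated_polygon {c..c + r + 1} (fan c r)"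
proof (induction r)
  case 0 then show ?case using triangulated_edge[of c] by simp
next
  case (Suc r)
  then show ?case using triangulated_glue[OF Suc.IH triangulated_edge] by simp
qed

lemma fan_edge: "t \<le> r \<Longrightarrow> (c, c + t + 1) \<in> fan c r"
  by (induction r) (auto simp: le_Suc_eq)

text \<open>
  A fan at \<open>x + 1\<close>, closed by a triangle with first vertex \<open>x\<close>. All vertices but \<open>x\<close> and \<open>x + k + 3\<close> are
  enclosed by the edge between these two, and among the enclosed ones the vertex \<open>x + 1\<close> is adjacent
  to the \<open>k + 1\<close> others.
\<close>

definition gadget :: "nat \<Rightarrow> nat \<Rightarrow> (nat \<times> nat) set" where
  "gadget k x = insert (x, x + k + 3) ({(x, x + 1)} \<union> fan (x + 1) (k + 1))"

lemma triangulated_gadget: "triangulated_polygon {x..x + k + 3} (gadget k x)"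
  using triangulated_glue[OF triangulated_edge[of x], of "x + k + 3" "fan (x + 1) (k + 1)"]
    triangulated_fan[of "x + 1" "k + 1"] unfolding gadget_def by (simp add: add.commute add.left_commute numeral_3_eq_3)

text \<open>
  The ends of the gadgets form a polygon, which is triangulated by joining all of them to 0.
\<close>

fun chain :: "nat \<Rightarrow> nat \<Rightarrow> (nat \<times> nat) set" where
  "chain k 0 = gadget k 0"
| "chain k (Suc q) = (let x = Suc q * (k + 4) in
     insert (0, x + k + 3) (insert (0, x) (chain k q \<union> {(x - 1, x)}) \<union> gadget k x))"

lemma triangulated_chain: "triangulated_polygon {0..q * (k + 4) + k + 3} (chain k q)"
proof (induction q)
  case 0 then show ?case using triangulated_gadget[of 0 k] by simp
next
  case (Suc q)
  let ?e = "q * (k + 4) + k + 3" and ?x = "Suc q * (k + 4)"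
  have x: "Suc ?e = ?x" "?x - 1 = ?e" by simp_all
  have "triangulated_polygon {0..?x} (insert (0, ?x) (chain k q \<union> {(?e, ?x)}))"
    using triangulated_glue[OF Suc.IH triangulated_edge[of ?e]] unfolding x(1) by simp
  from triangulated_glue[OF this triangulated_gadget[of ?x k]]
  show ?case unfolding chain.simps Let_def x(2) by simp
qed

lemma gadget_chain: "r \<le> q \<Longrightarrow> gadget k (r * (k + 4)) \<subseteq> chain k q"
  by (induction q) (auto simp: le_Suc_eq Let_def)

context
  fixes k q n :: nat and E :: "(nat \<times> nat) set" and G :: plane_graph
  defines "n \<equiv> Suc q * (k + 4)" and "E \<equiv> chain k q" and "G \<equiv> drawing n E"
begin

lemma drawn_chain: "drawn_polygon n E"
proof -
  have "{0..q * (k + 4) + k + 3} = {..<n}" by (auto simp: n_def)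
  then interpret triangulated_polygon "{..<n}" E using triangulated_chain[of q k] by (simp add: E_def)
  show ?thesis by unfold_locales (simp add: n_def)
qed

interpretation drawn_polygon n E by (rule drawn_chain)

text \<open>
  Otherwise no inner vertex of the gadget is dominated, because all its neighbours are in the gadget; so
  the star in the middle of the gadget survives.
\<close>

lemma star_isolating_meets_gadget:
  assumes "star_isolating k G S" "r \<le> q"
  shows "\<exists>i. r * (k + 4) \<le> i \<and> i \<le> r * (k + 4) + k + 3 \<and> node i \<in> S"
proof (rule ccontr)
  assume no: "\<not> ?thesis"
  let ?x = "r * (k + 4)" and ?R = "verts G - closed_nbhd G S"
  have gE: "gadget k ?x \<subseteq> E" unfolding E_def by (rule gadget_chain) fact
  have "(?x, ?x + k + 3) \<in> gadget k ?x" by (simp add: gadget_def)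
  then have xE: "(?x, ?x + k + 3) \<in> E" using gE by blast
  have inner: "node i \<in> ?R" if i: "?x < i" "i < ?x + k + 3" for i
  proof -
    have "i < n" using edge_less[OF xE] i by linarith
    moreover have "node i \<notin> S" using no i by auto
    moreover have "u \<notin> S" if u: "{u, node i} \<in> edges G" for u
    proof -
      obtain w where w: "u = node w" "adj E i w"
        using u by (auto simp: G_def adj_def doubleton_eq_iff)
      from adj_between[OF xE i w(2)] show ?thesis using no w(1) by auto
    qed
    ultimately show ?thesis by (auto simp: closed_nbhd_def G_def)
  qed
  have "contains_copy (induced G ?R) (star (k + 1))"
    unfolding contains_copy_def
  proof (intro exI[of _ "\<lambda>i. node (?x + 1 + i)"] conjI ballI)
    show "inj_on (\<lambda>i. node (?x + 1 + i)) (verts (star (k + 1)))" by (simp add: inj_on_def)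
    show "(\<lambda>i. node (?x + 1 + i)) ` verts (star (k + 1)) \<subseteq> verts (induced G ?R)"
      using inner by (auto simp: star_def induced_def)
    fix e assume "e \<in> edges (star (k + 1))"
    then obtain i where i: "1 \<le> i" "i \<le> k + 1" "e = {0, i}" by (auto simp: star_def)
    have "(?x + 1, ?x + 1 + i) \<in> fan (?x + 1) (k + 1)" using fan_edge[of "i - 1" "k + 1" "?x + 1"] i by simp
    then have "(?x + 1, ?x + 1 + i) \<in> E" using gE by (auto simp: gadget_def)
    then have "{node (?x + 1), node (?x + 1 + i)} \<in> edges G" unfolding G_def drawing_simps by blast
    moreover have "node (?x + 1) \<in> ?R" "node (?x + 1 + i) \<in> ?R" using inner i by simp_all
    ultimately show "(\<lambda>i. node (?x + 1 + i)) ` e \<in> edges (induced G ?R)"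
      by (simp add: i(3) induced_def)
  qed
  then show False using assms(1) by (simp add: star_isolating_def)
qed

lemma iota_chain: "mop G" "graph_order G = n" "iota k G = Suc q"
proof -
  show m: "mop G" unfolding G_def by (rule mop_G)
  show o: "graph_order G = n" by (simp add: graph_order_def G_def card_image inj_on_def)
  have "finite (verts G)" by (simp add: G_def)
  then obtain S where S: "star_isolating k G S" "card S = iota k G" using iota_attained(1) by blast
  define T where "T = {i. i < n \<and> node i \<in> S}"
  have fT: "finite T" by (simp add: T_def)
  have ST: "S = node ` T" using S(1) by (auto simp: star_isolating_def T_def G_def)
  have "{..q} \<subseteq> (\<lambda>i. i div (k + 4)) ` T"
  proof
    fix r assume "r \<in> {..q}"
    then obtain i where i: "r * (k + 4) \<le> i" "i \<le> r * (k + 4) + k + 3" "node i \<in> S"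
      using star_isolating_meets_gadget[OF S(1)] by auto
    have "i div (k + 4) = r" using i by (intro div_nat_eqI) (auto simp: algebra_simps)
    moreover have "i \<in> T" using i(3) unfolding ST by auto
    ultimately show "r \<in> (\<lambda>i. i div (k + 4)) ` T" by auto
  qed
  then have "card {..q} \<le> card ((\<lambda>i. i div (k + 4)) ` T)" using fT by (intro card_mono) auto
  also have "\<dots> \<le> card T" using fT by (rule card_image_le)
  also have "card T = card S" unfolding ST by (simp add: card_image inj_on_def)
  finally have "Suc q \<le> iota k G" using S(2) by simp
  moreover have "iota k G \<le> n div (k + 4)"
    using mop_iota_le[OF m, of k] o by (simp add: n_def)
  moreover have "n div (k + 4) = Suc q" unfolding n_def by (rule nonzero_mult_div_cancel_right) simp
  ultimately show "iota k G = Suc q" by linarith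
qed

end

theorem theorem4:
  fixes k :: nat
  shows "(\<forall>G. mop G \<and> graph_order G \<ge> k + 4 \<longrightarrow> real (iota k G) \<le> real (graph_order G) / real (k + 4)) \<and>
         infinite {n. \<exists>G. mop G \<and> graph_order G = n \<and> n \<ge> k + 4 \<and>
                         real (iota k G) = real n / real (k + 4)}"
proof (intro conjI allI impI)
  fix G assume "mop G \<and> graph_order G \<ge> k + 4"
  then have "iota k G \<le> graph_order G div (k + 4)" using mop_iota_le by blast
  then have "iota k G * (k + 4) \<le> graph_order G div (k + 4) * (k + 4)" by (rule mult_le_mono1)
  also have "\<dots> \<le> graph_order G" by (rule div_times_less_eq_dividend)
  finally have "real (iota k G * (k + 4)) \<le> real (graph_order G)" by (rule of_nat_mono)
  then show "real (iota k G) \<le> real (graph_order G) / real (k + 4)"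
    by (simp only: of_nat_mult) (simp add: le_divide_eq)
next
  let ?N = "{n. \<exists>G. mop G \<and> graph_order G = n \<and> n \<ge> k + 4 \<and> real (iota k G) = real n / real (k + 4)}"
  have "range (\<lambda>q. Suc q * (k + 4)) \<subseteq> ?N"
  proof
    fix n assume "n \<in> range (\<lambda>q. Suc q * (k + 4))"
    then obtain q where q: "n = Suc q * (k + 4)" by auto
    have "real (Suc q) = real n / real (k + 4)" unfolding q of_nat_mult by (rule nonzero_mult_div_cancel_right[symmetric]) simp
    moreover have "k + 4 \<le> n" unfolding q by simp
    ultimately show "n \<in> ?N" using iota_chain(1,2)[of q k] iota_chain(3)[of k q] unfolding q by auto
  qed
  moreover have "infinite (range (\<lambda>q. Suc q * (k + 4)))"
    by (rule range_inj_infinite) (simp add: inj_on_def)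
  ultimately show "infinite ?N" by (rule infinite_super)
qed

end
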